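(* The space $\omega\mathbf{CEA}$ has an intermediate $\sigma$-homeomorphism type, that is, $$\{0,1\}^{\mathbb N}<_\sigma\omega\mathbf{CEA}<_\sigma[0,1]^{\mathbb N}.$$
   Context: A function $f:X\to Y$ between topological spaces is $\sigma$-continuous if $X=\bigcup_{n\in\mathbb N}X_n$ for some sets $X_n$ with each $f|_{X_n}$ continuous. A $\sigma$-homeomorphism is a bijection $f$ such that $f$ and $f^{-1}$ are $\sigma$-continuous. $X$ $\sigma$-embeds into $Y$, written $X\le_\sigma Y$, if $X$ is $\sigma$-homeomorphic to a subspace of $Y$; $X<_\sigma Y$ means $X\le_\sigma Y$ and $X$ is not $\sigma$-homeomorphic to $Y$. For $k\in\mathbb N$ let $(B^k_i)_{i\in\mathbb N}$ be a standard effective enumeration of the rational open balls of $\{0,1\}^{\mathbb N}\times[0,1]^k$. For a c.e. set $W\subseteq\mathbb N\times\mathbb Q$ and $z\in\{0,1\}^{\mathbb N}\times[0,1]^k$ let $J^k_W(z)=\sup\{\min\{|q|,1\}: z\in B^k_i\text{ for some }(i,q)\in W\}$ (with $\sup\emptyset=0$). Let $((W_{e,k})_{k\in\mathbb N})_{e\in\mathbb N}$ be a standard effective enumeration of all uniformly c.e. sequences of subsets of $\mathbb N\times\mathbb Q$. The $e$-th $\omega$-left-CEA operator $J^\omega_e:\{0,1\}^{\mathbb N}\to[0,1]^{\mathbb N}$ is $J^\omega_e(x)=(r_0,r_1,\dots)$ with $r_k=J^k_{W_{e,k}}(x,r_0,\dots,r_{k-1})$. The space $\omega\mathbf{CEA}$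 is the graph of the universal $\omega$-left-CEA operator, $$\omega\mathbf{CEA}=\{(e,x,r)\in\mathbb N\times\{0,1\}^{\mathbb N}\times[0,1]^{\mathbb N}: r=J^\omega_e(x)\},$$ with the subspace topology. *)

theory Defs
  imports "HOL-Analysis.Analysis" "HOL-Library.Nat_Bijection"
begin

section \<open>\<open>\<sigma>\<close>-continuity and \<open>\<sigma>\<close>-embeddings\<close>

definition sigma_continuous_map :: "'a topology \<Rightarrow> 'b topology \<Rightarrow> ('a \<Rightarrow> 'b) \<Rightarrow> bool" where
  "sigma_continuous_map X Y f \<longleftrightarrow>
     (\<exists>A :: nat \<Rightarrow> 'a set. topspace X = (\<Union>n. A n) \<and>
        (\<forall>n. continuous_map (subtopology X (A n)) Y f))"

definition sigma_homeomorphic_map :: "'a topology \<Rightarrow> 'b topology \<Rightarrow> ('a \<Rightarrow> 'b) \<Rightarrow> bool" where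
  "sigma_homeomorphic_map X Y f \<longleftrightarrow>
     bij_betw f (topspace X) (topspace Y) \<and>
     sigma_continuous_map X Y f \<and>
     sigma_continuous_map Y X (inv_into (topspace X) f)"

definition sigma_homeomorphic_space :: "'a topology \<Rightarrow> 'b topology \<Rightarrow> bool" where
  "sigma_homeomorphic_space X Y \<longleftrightarrow> (\<exists>f. sigma_homeomorphic_map X Y f)"

definition sigma_embeds :: "'a topology \<Rightarrow> 'b topology \<Rightarrow> bool"  (infix "\<le>\<^sub>\<sigma>" 50) where
  "X \<le>\<^sub>\<sigma> Y \<longleftrightarrow> (\<exists>S \<subseteq> topspace Y. sigma_homeomorphic_space X (subtopology Y S))"

definition sigma_less :: "'a topology \<Rightarrow> 'b topology \<Rightarrow> bool"  (infix "<\<^sub>\<sigma>" 50) where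
  "X <\<^sub>\<sigma> Y \<longleftrightarrow> X \<le>\<^sub>\<sigma> Y \<and> \<not> sigma_homeomorphic_space X Y"


section \<open>Partial recursive functions and their Goedel numbering\<close>

text \<open>
  Programs for the unary partial recursive functions. Several arguments are passed as one number
  via the bijection \<^const>\<open>prod_encode\<close>; the identity is \<open>PPair PFst PSnd\<close>.
\<close>

datatype prog =
  PZero | PSucc | PFst | PSnd
| PPair prog prog | PComp prog prog | PRec prog prog | PMin prog

inductive computes :: "prog \<Rightarrow> nat \<Rightarrow> nat \<Rightarrow> bool" where
  zero: "computes PZero x 0"
| succ: "computes PSucc x (Suc x)"
| fst: "computes PFst (prod_encode (a, b)) a"
| snd: "computes PSnd (prod_encode (a, b)) b"
| pair: "computes p x a \<Longrightarrow> computes q x b \<Longrightarrow> computes (PPair p q) x (prod_encode (a, b))"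
| comp: "computes q x y \<Longrightarrow> computes p y z \<Longrightarrow> computes (PComp p q) x z"
| rec_0: "computes p a y \<Longrightarrow> computes (PRec p q) (prod_encode (a, 0)) y"
| rec_Suc: "computes (PRec p q) (prod_encode (a, n)) y \<Longrightarrow>
    computes q (prod_encode (a, prod_encode (n, y))) z \<Longrightarrow>
    computes (PRec p q) (prod_encode (a, Suc n)) z"
| min: "\<forall>m<n. \<exists>y. computes p (prod_encode (a, m)) (Suc y) \<Longrightarrow>
    computes p (prod_encode (a, n)) 0 \<Longrightarrow> computes (PMin p) a n"

primrec goedel_number :: "prog \<Rightarrow> nat" where
  "goedel_number PZero = 0"
| "goedel_number PSucc = 1"
| "goedel_number PFst = 2"
| "goedel_number PSnd = 3"
| "goedel_number (PPair p q) = 4 + 4 * prod_encode (goedel_number p, goedel_number q)"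
| "goedel_number (PComp p q) = 5 + 4 * prod_encode (goedel_number p, goedel_number q)"
| "goedel_number (PRec p q) = 6 + 4 * prod_encode (goedel_number p, goedel_number q)"
| "goedel_number (PMin p) = 7 + 4 * goedel_number p"

lemma inj_goedel_number: "goedel_number p = goedel_number q \<Longrightarrow> p = q"
proof (induction p arbitrary: q)
  case PZero then show ?case by (cases q) auto
next
  case PSucc then show ?case by (cases q) auto
next
  case PFst then show ?case by (cases q) auto
next
  case PSnd then show ?case by (cases q) auto
next
  case (PPair p1 p2) then show ?case by (cases q) (auto, presburger+)
next
  case (PComp p1 p2) then show ?case by (cases q) (auto, presburger+)
next
  case (PRec p1 p2) then show ?case by (cases q) (auto, presburger+)
next
  case (PMin p) then show ?case by (cases q) (auto, presburger+)
qed

lemma surj_goedel_number: "\<exists>p. goedel_number p = e"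
proof (induction e rule: less_induct)
  case (less e)
  show ?case
  proof (cases "e < 4")
    case True
    then have "e = 0 \<or> e = 1 \<or> e = 2 \<or> e = 3" by auto
    then show ?thesis by (metis goedel_number.simps(1-4))
  next
    case False
    define m where "m = (e - 4) div 4"
    obtain a b where ab: "m = prod_encode (a, b)" by (metis prod_decode_inverse surj_pair)
    have "m < e" using False by (simp add: m_def)
    moreover have "a \<le> m" "b \<le> m" using ab le_prod_encode_1 le_prod_encode_2 by auto
    ultimately obtain p q r
      where "goedel_number p = a" "goedel_number q = b" "goedel_number r = m"
      by (meson less le_less_trans)
    moreover have "e = 4 + 4 * m \<or> e = 5 + 4 * m \<or> e = 6 + 4 * m \<or> e = 7 + 4 * m"
      using False unfolding m_def by presburger
    ultimately show ?thesis by (metis ab goedel_number.simps(5-8))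
  qed
qed

lemma bij_goedel_number: "bij goedel_number"
  unfolding bij_def inj_def surj_def by (metis inj_goedel_number surj_goedel_number)

definition prog_of :: "nat \<Rightarrow> prog" where
  "prog_of = inv goedel_number"

definition rat_of_code :: "nat \<Rightarrow> rat" where
  "rat_of_code n = (case prod_decode n of (a, b) \<Rightarrow> Fract (int_decode a) (int (Suc b)))"

text \<open>
  A sequence of subsets of \<open>\<nat> \<times> \<rat>\<close> is uniformly c.e. iff it is of the form
  \<open>\<lambda>k. W_set e k\<close> for some \<open>e\<close>: c.e. sets are the domains of partial recursive functions, and
  \<^const>\<open>rat_of_code\<close> is an effective surjection onto the rationals.
\<close>

definition W_set :: "nat \<Rightarrow> nat \<Rightarrow> (nat \<times> rat) set" where
  "W_set e k = {(i, rat_of_code n) | i n.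
     \<exists>y. computes (prog_of e) (prod_encode (k, prod_encode (i, n))) y}"


section \<open>Rational open balls of \<open>{0,1}\<^sup>\<nat> \<times> [0,1]\<^sup>k\<close>\<close>

text \<open>
  Points of \<open>{0,1}\<^sup>\<nat>\<close> are functions \<^typ>\<open>nat \<Rightarrow> bool\<close>, points of \<open>[0,1]\<^sup>k\<close> are lists of
  length \<open>k\<close>. Balls are taken in the maximum metric. Their centres are the points \<open>(\<sigma>, c)\<close> with
  \<open>\<sigma>\<close> eventually \<^const>\<open>False\<close> (given by the binary digits of a natural number) and \<open>c\<close> a vector
  of rationals in \<open>[0,1]\<close>; their radii are the positive rationals.
\<close>

definition cantor_dist :: "(nat \<Rightarrow> bool) \<Rightarrow> (nat \<Rightarrow> bool) \<Rightarrow> real" where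
  "cantor_dist x y = (if x = y then 0 else (1/2) ^ (LEAST n. x n \<noteq> y n))"

definition cube :: "nat \<Rightarrow> real list set" where
  "cube k = {r. length r = k \<and> set r \<subseteq> {0..1}}"

definition open_ball ::
    "nat \<Rightarrow> (nat \<Rightarrow> bool) \<Rightarrow> real list \<Rightarrow> real \<Rightarrow> ((nat \<Rightarrow> bool) \<times> real list) set" where
  "open_ball k \<sigma> c \<rho> =
     {(x, r). r \<in> cube k \<and> cantor_dist \<sigma> x < \<rho> \<and> (\<forall>j<k. \<bar>c ! j - r ! j\<bar> < \<rho>)}"

definition unit_rat_of_code :: "nat \<Rightarrow> real" where
  "unit_rat_of_code n = (case prod_decode n of (a, b) \<Rightarrow> real (min a (Suc b)) / real (Suc b))"

primrec tuple_decode :: "nat \<Rightarrow> nat \<Rightarrow> nat list" where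
  "tuple_decode 0 n = []"
| "tuple_decode (Suc k) n = (case prod_decode n of (a, m) \<Rightarrow> a # tuple_decode k m)"

definition rational_ball :: "nat \<Rightarrow> nat \<Rightarrow> ((nat \<Rightarrow> bool) \<times> real list) set" where
  "rational_ball k i =
     (case prod_decode i of (u, v) \<Rightarrow>
      case prod_decode u of (s, t) \<Rightarrow>
      case prod_decode v of (a, b) \<Rightarrow>
        open_ball k (bit s) (map unit_rat_of_code (tuple_decode k t)) (real (Suc a) / real (Suc b)))"


section \<open>\<open>\<omega>\<close>-left-CEA operators\<close>

text \<open>
  Inserting \<open>0\<close> only affects the empty case: all other elements are nonnegative, and the
  supremum of the empty set of reals is unspecified.
\<close>

definition J_op :: "nat \<Rightarrow> (nat \<times> rat) set \<Rightarrow> (nat \<Rightarrow> bool) \<times> real list \<Rightarrow> real" where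
  "J_op k W z =
     Sup (insert 0 {min \<bar>real_of_rat q\<bar> 1 | i q. (i, q) \<in> W \<and> z \<in> rational_ball k i})"

fun J_omega :: "nat \<Rightarrow> (nat \<Rightarrow> bool) \<Rightarrow> nat \<Rightarrow> real" where
  "J_omega e x k = J_op k (W_set e k) (x, map (J_omega e x) [0..<k])"


section \<open>The three spaces\<close>

definition cantor_space :: "(nat \<Rightarrow> bool) topology" where
  "cantor_space = euclidean"

definition hilbert_cube :: "(nat \<Rightarrow> real) topology" where
  "hilbert_cube = top_of_set {r. \<forall>k. r k \<in> {0..1}}"

text \<open>
  The type topology here is the product one, with \<^typ>\<open>nat\<close> discrete. All values
  \<open>J_omega e x k\<close> lie in \<open>[0,1]\<close>, so this is the subspace topology from
  \<open>\<nat> \<times> {0,1}\<^sup>\<nat> \<times> [0,1]\<^sup>\<nat>\<close>.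
\<close>

definition omega_CEA :: "(nat \<times> (nat \<Rightarrow> bool) \<times> (nat \<Rightarrow> real)) topology" where
  "omega_CEA = top_of_set {(e, x, r). (\<forall>k. r k \<in> {0..1}) \<and> r = J_omega e x}"

end

theory Submission
  imports Defs
begin

text \<open>
  Call a set \<open>C\<close> of points of the Hilbert cube essential in a set \<open>S\<close> of directions if \<open>C\<close> meets the
  intersection of any partitions between the pairs of opposite faces with directions in \<open>S\<close>. By
  Kuhn's combinatorial lemma the cube is essential in all directions.

  The Hilbert cube is not a countable union of sets \<open>X\<^sub>n\<close> with continuous injections \<open>g\<^sub>n\<close> into
  \<open>{0,1}\<^sup>\<nat>\<close>: one builds a decreasing sequence of compact sets, each essential in infinitely many
  directions, the \<open>n\<close>-th step avoiding \<open>X\<^sub>n\<close>. Either the set where some extension of a bit of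
  \<open>g\<^sub>n\<close> is undefined is still essential, or partitions can be used up to make all bits defined, and
  then some fibre of \<open>g\<^sub>n\<close> is essential and contains at most one point of \<open>X\<^sub>n\<close>. Each \<open>e\<close>-section of
  \<open>\<omega>CEA\<close> is a graph over \<open>{0,1}\<^sup>\<nat>\<close>, so the cube is not \<open>\<sigma>\<close>-homeomorphic to \<open>\<omega>CEA\<close>.

  Conversely, the lexicographic minimum of an effectively closed subset of the cube is given by an
  \<open>\<omega>\<close>-left-CEA operator. Hence there is one \<open>e\<close> such that every closed \<open>M \<subseteq> {0,1}\<^sup>\<nat> \<times> [0,1]\<^sup>\<nat>\<close>
  with nonempty sections has a point \<open>(c, J\<^sub>e(c))\<close>, where \<open>c\<close> is a code of \<open>M\<close>. If \<open>\<omega>CEA\<close> were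
  \<open>\<sigma>\<close>-homeomorphic to \<open>{0,1}\<^sup>\<nat>\<close>, its \<open>e\<close>-section would be a union of zero-dimensional sets \<open>Z\<^sub>n\<close>;
  taking for \<open>M\<close> the intersection of partitions between the \<open>n\<close>-th pair of faces that miss \<open>Z\<^sub>n\<close>
  gives a contradiction.
\<close>


section \<open>Essential sets in the Hilbert cube\<close>

definition unit_cube :: "(nat \<Rightarrow> real) set" where
  "unit_cube = {r. \<forall>k. r k \<in> {0..1}}"

lemma tendsto_fun_iff:
  fixes l :: "'a \<Rightarrow> 'b::topological_space"
  shows "(f \<longlongrightarrow> l) F \<longleftrightarrow> (\<forall>i. ((\<lambda>x. f x i) \<longlongrightarrow> l i) F)"
  using limitin_componentwise[of "\<lambda>_::'a. euclidean::'b topology" UNIV f l F]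
  by (simp add: euclidean_product_topology)

lemma compact_unit_cube: "compact unit_cube"
proof -
  have "compactin (product_topology (\<lambda>_::nat. euclidean) UNIV) (PiE UNIV (\<lambda>_. {0..1::real}))"
    by (simp add: compactin_PiE)
  moreover have "PiE UNIV (\<lambda>_. {0..1::real}) = unit_cube"
    by (auto simp: unit_cube_def PiE_def)
  ultimately show ?thesis
    by (simp add: euclidean_product_topology)
qed

lemma unit_cube_convergent_subsequence:
  assumes "\<And>n::nat. f n \<in> unit_cube"
  obtains z \<phi> where "z \<in> unit_cube" "strict_mono (\<phi> :: nat \<Rightarrow> nat)" "(\<lambda>n. f (\<phi> n)) \<longlonglongrightarrow> z"
  using compact_imp_seq_compact[OF compact_unit_cube] assms unfolding seq_compact_def o_def by metis

text \<open>The partition itself is the complement of \<open>U \<union> V\<close>. Keeping its two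
  open sides instead lets partitions be glued by unions and intersections.\<close>

definition separates :: "nat \<Rightarrow> (nat \<Rightarrow> real) set \<Rightarrow> (nat \<Rightarrow> real) set \<Rightarrow> bool" where
  "separates i U V \<longleftrightarrow> open U \<and> open V \<and> U \<inter> V = {} \<and>
     {r \<in> unit_cube. r i = 0} \<subseteq> U \<and> {r \<in> unit_cube. r i = 1} \<subseteq> V"

definition essential :: "nat set \<Rightarrow> (nat \<Rightarrow> real) set \<Rightarrow> bool" where
  "essential S C \<longleftrightarrow> (\<forall>U V. (\<forall>i\<in>S. separates i (U i) (V i)) \<longrightarrow> (\<exists>z\<in>C. \<forall>i\<in>S. z \<notin> U i \<union> V i))"

text \<open>Kuhn's lemma on ever finer grids of growing dimension yields small cells with vertices
  both inside and outside \<open>U i\<close>, for every direction \<open>i\<close> of the grid. By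
  compactness the cells accumulate at a point of the cube, which lies on all partitions.\<close>

lemma essential_unit_cube: "essential UNIV unit_cube"
  unfolding essential_def
proof (intro allI impI)
  fix U V :: "nat \<Rightarrow> (nat \<Rightarrow> real) set"
  assume sep: "\<forall>i\<in>UNIV. separates i (U i) (V i)"
  \<comment> \<open>Grid points of mesh \<open>1 / Suc n\<close> in dimension \<open>n\<close>,
    padded by zeros to points of the Hilbert cube, so that dimension and fineness grow
    together.\<close>
  define pt where "pt n x = (\<lambda>j. if j < n then real (x j) / real (Suc n) else 0)" for n and x :: "nat \<Rightarrow> nat"
  have pt_cube: "pt n x \<in> unit_cube" if "\<forall>j<n. x j \<le> Suc n" for n x
    using that by (auto simp: pt_def unit_cube_def divide_simps)
  have kuhn: "\<exists>q. (\<forall>i<n. q i < Suc n) \<and>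
      (\<forall>i<n. \<exists>r s. (\<forall>j<n. q j \<le> r j \<and> r j \<le> q j + 1) \<and> (\<forall>j<n. q j \<le> s j \<and> s j \<le> q j + 1) \<and>
         pt n r \<in> U i \<and> pt n s \<notin> U i)" for n
  proof -
    define label where "label x i = (if pt n x \<in> U i then 0 else 1::nat)" for x i
    have 0: "label x i = 0" if "\<forall>j<n. x j \<le> Suc n" "i < n" "x i = 0" for x i
    proof -
      have "pt n x \<in> {r \<in> unit_cube. r i = 0}" using that pt_cube[of n x] by (auto simp: pt_def)
      then have "pt n x \<in> U i" using sep unfolding separates_def by blast
      then show ?thesis by (simp add: label_def)
    qed
    have 1: "label x i = 1" if "\<forall>j<n. x j \<le> Suc n" "i < n" "x i = Suc n" for x i
    proof -
      have "pt n x \<in> {r \<in> unit_cube. r i = 1}" using that pt_cube[of n x] by (auto simp: pt_def)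
      then have "pt n x \<notin> U i" using sep unfolding separates_def by blast
      then show ?thesis by (simp add: label_def)
    qed
    obtain q where q: "\<forall>i<n. q i < Suc n"
      "\<forall>i<n. \<exists>r s. (\<forall>j<n. q j \<le> r j \<and> r j \<le> q j + 1) \<and> (\<forall>j<n. q j \<le> s j \<and> s j \<le> q j + 1) \<and> label r i \<noteq> label s i"
      by (rule kuhn_lemma[of "Suc n" n label]) (use 0 1 in \<open>auto simp: label_def\<close>)
    show ?thesis
    proof (rule exI[of _ q], intro conjI allI impI)
      fix i assume "i < n"
      with q(2) obtain r s where rs: "\<forall>j<n. q j \<le> r j \<and> r j \<le> q j + 1"
        "\<forall>j<n. q j \<le> s j \<and> s j \<le> q j + 1" "label r i \<noteq> label s i" by blast
      then have "(pt n r \<in> U i \<and> pt n s \<notin> U i) \<or> (pt n s \<in> U i \<and> pt n r \<notin> U i)"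
        by (auto simp: label_def split: if_splits)
      with rs show "\<exists>r s. (\<forall>j<n. q j \<le> r j \<and> r j \<le> q j + 1) \<and> (\<forall>j<n. q j \<le> s j \<and> s j \<le> q j + 1) \<and>
         pt n r \<in> U i \<and> pt n s \<notin> U i" by blast
    qed (use q in auto)
  qed
  define good where "good n q i r s \<longleftrightarrow> (\<forall>j<n. q j \<le> r j \<and> r j \<le> q j + 1) \<and>
      (\<forall>j<n. q j \<le> s j \<and> s j \<le> q j + 1) \<and> pt n r \<in> U i \<and> pt n s \<notin> U i"
    for n i and q r s :: "nat \<Rightarrow> nat"
  have "\<forall>n. \<exists>q. (\<forall>i<n. q i < Suc n) \<and> (\<forall>i<n. \<exists>r s. good n q i r s)"
    unfolding good_def using kuhn by blast
  then obtain q where q: "\<And>n. \<forall>i<n. q n i < Suc n"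
    and ex: "\<And>n i. i < n \<Longrightarrow> \<exists>r s. good n (q n) i r s"
    by metis
  have "\<forall>n i. \<exists>p. i < n \<longrightarrow> good n (q n) i (fst p) (snd p)"
    using ex by auto
  then obtain p where p: "\<And>n i. i < n \<Longrightarrow> good n (q n) i (fst (p n i)) (snd (p n i))"
    unfolding choice_iff by blast
  define r s where "r n i = fst (p n i)" and "s n i = snd (p n i)" for n i
  have
    r: "\<And>n i j. i < n \<Longrightarrow> j < n \<Longrightarrow> q n j \<le> r n i j \<and> r n i j \<le> q n j + 1" and
    s: "\<And>n i j. i < n \<Longrightarrow> j < n \<Longrightarrow> q n j \<le> s n i j \<and> s n i j \<le> q n j + 1" and
    rU: "\<And>n i. i < n \<Longrightarrow> pt n (r n i) \<in> U i" and sU: "\<And>n i. i < n \<Longrightarrow> pt n (s n i) \<notin> U i"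
    using p unfolding good_def r_def s_def by blast+
  have "pt n (q n) \<in> unit_cube" for n
    using q[of n] by (intro pt_cube) (auto intro: less_imp_le)
  then obtain z \<phi> where z: "z \<in> unit_cube" and \<phi>: "strict_mono \<phi>" and lim: "(\<lambda>n. pt (\<phi> n) (q (\<phi> n))) \<longlonglongrightarrow> z"
    by (rule unit_cube_convergent_subsequence)
  \<comment> \<open>The chosen vertices share the limit of the corners \<open>q n\<close>:
    coordinates below \<open>n\<close> differ by at most \<open>1 / Suc n\<close>, the others are
    all 0.\<close>
  have close: "(\<lambda>n. pt (\<phi> n) (r' (\<phi> n))) \<longlonglongrightarrow> z"
    if r': "\<And>n j. i < n \<Longrightarrow> j < n \<Longrightarrow> q n j \<le> r' n j \<and> r' n j \<le> q n j + 1" for r' i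
  proof -
    have "(\<lambda>n. pt (\<phi> n) (r' (\<phi> n)) j) \<longlonglongrightarrow> z j" for j
    proof (rule Lim_transform)
      show "(\<lambda>n. pt (\<phi> n) (q (\<phi> n)) j) \<longlonglongrightarrow> z j"
        using lim unfolding tendsto_fun_iff[of "\<lambda>n. pt (\<phi> n) (q (\<phi> n))"] by blast
      show "(\<lambda>n. pt (\<phi> n) (r' (\<phi> n)) j - pt (\<phi> n) (q (\<phi> n)) j) \<longlonglongrightarrow> 0"
      proof (rule Lim_null_comparison)
        have "norm (pt n (r' n) j - pt n (q n) j) \<le> inverse (real (Suc n))" if "n > i + j" for n
          using r'[of n j] that by (auto simp: pt_def divide_simps)
        moreover have "eventually (\<lambda>n. \<phi> n > i + j) sequentially"
          using eventually_compose_filterlim[OF eventually_gt_at_top filterlim_subseq[OF \<phi>]] .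
        ultimately show "\<forall>\<^sub>F n in sequentially. norm (pt (\<phi> n) (r' (\<phi> n)) j - pt (\<phi> n) (q (\<phi> n)) j)
            \<le> inverse (real (Suc (\<phi> n)))"
          by (auto elim: eventually_mono)
        show "(\<lambda>n. inverse (real (Suc (\<phi> n)))) \<longlonglongrightarrow> 0"
          using LIMSEQ_subseq_LIMSEQ[OF LIMSEQ_inverse_real_of_nat \<phi>] by (simp add: o_def)
      qed
    qed
    then show ?thesis by (simp add: tendsto_fun_iff)
  qed
  \<comment> \<open>\<open>z\<close> is a limit of points outside the open set \<open>U i\<close>,
    and also of points inside \<open>U i\<close>, which the open set \<open>V i\<close> does not
    meet.\<close>
  have "z \<notin> U i \<union> V i" for i
  proof
    have ev: "eventually (\<lambda>n. \<phi> n > i) sequentially"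
      using eventually_compose_filterlim[OF eventually_gt_at_top filterlim_subseq[OF \<phi>]] .
    have sep_i: "open (U i)" "open (V i)" "U i \<inter> V i = {}" using sep by (auto simp: separates_def)
    assume "z \<in> U i \<union> V i"
    then show False
    proof
      assume "z \<in> U i"
      moreover have "(\<lambda>n. pt (\<phi> n) (s (\<phi> n) i)) \<longlonglongrightarrow> z"
        using close[of i "\<lambda>n. s n i"] s by auto
      ultimately have "eventually (\<lambda>n. pt (\<phi> n) (s (\<phi> n) i) \<in> U i) sequentially"
        using sep_i topological_tendstoD by blast
      with ev have "eventually (\<lambda>n. False) sequentially" by eventually_elim (use sU in blast)
      then show False by simp
    next
      assume "z \<in> V i"
      moreover have "(\<lambda>n. pt (\<phi> n) (r (\<phi> n) i)) \<longlonglongrightarrow> z"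
        using close[of i "\<lambda>n. r n i"] r by auto
      ultimately have "eventually (\<lambda>n. pt (\<phi> n) (r (\<phi> n) i) \<in> V i) sequentially"
        using sep_i topological_tendstoD by blast
      with ev have "eventually (\<lambda>n. False) sequentially" by eventually_elim (use rU sep_i in blast)
      then show False by simp
    qed
  qed
  with z show "\<exists>z\<in>unit_cube. \<forall>i\<in>UNIV. z \<notin> U i \<union> V i" by blast
qed

section \<open>Operations that preserve essential sets\<close>

lemma compact_nested_nonempty:
  fixes F :: "nat \<Rightarrow> 'a::t2_space set"
  assumes comp: "\<And>n. compact (F n)" and ne: "\<And>n. F n \<noteq> {}" and dec: "\<And>n. F (Suc n) \<subseteq> F n"
  shows "\<Inter>(range F) \<noteq> {}"
proof -
  have mono: "F m \<subseteq> F n" if "n \<le> m" for m n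
    using dec that by (rule lift_Suc_antimono_le)
  have "F 0 \<inter> \<Inter>(range F) \<noteq> {}"
  proof (rule compact_imp_fip[OF comp])
    fix T assume "T \<in> range F"
    then obtain n where "T = F n" ..
    then show "closed T" using compact_imp_closed[OF comp] by simp
  next
    fix F' assume "finite F'" "F' \<subseteq> range F"
    then obtain N where N: "finite N" "F' = F ` N" by (metis finite_subset_image)
    obtain m where m: "\<forall>n\<in>N. n \<le> m" using N(1) finite_nat_set_iff_bounded_le by auto
    have "F m \<subseteq> F 0 \<inter> \<Inter>F'"
    proof (intro Int_greatest Inter_greatest)
      show "F m \<subseteq> F 0" by (rule mono) simp
      fix T assume "T \<in> F'"
      then obtain n where "n \<in> N" "T = F n" unfolding N(2) by (rule imageE)
      then show "F m \<subseteq> T" using mono m by simp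
    qed
    then show "F 0 \<inter> \<Inter>F' \<noteq> {}" using ne[of m] by (metis subset_empty)
  qed
  then show ?thesis by (metis Int_empty_right)
qed

lemma essentialD:
  assumes "essential S C" "\<And>i. i \<in> S \<Longrightarrow> separates i (U i) (V i)"
  shows "\<exists>z\<in>C. \<forall>i\<in>S. z \<notin> U i \<union> V i"
  using assms(1)[unfolded essential_def, rule_format, of U V] assms(2) by metis

lemma not_essentialE:
  assumes "\<not> essential S C"
  obtains U V where "\<And>i. i \<in> S \<Longrightarrow> separates i (U i) (V i)" "\<And>z. z \<in> C \<Longrightarrow> \<exists>i\<in>S. z \<in> U i \<union> V i"
proof -
  from assms obtain U V where "\<forall>i\<in>S. separates i (U i) (V i)" and *: "\<not> (\<exists>z\<in>C. \<forall>i\<in>S. z \<notin> U i \<union> V i)"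
    unfolding essential_def not_all not_imp by (elim exE conjE)
  then have "\<And>i. i \<in> S \<Longrightarrow> separates i (U i) (V i)" by simp
  moreover from * have "\<And>z. z \<in> C \<Longrightarrow> \<exists>i\<in>S. z \<in> U i \<union> V i" by auto
  ultimately show thesis by (rule that)
qed

text \<open>The open halves below and above \<open>1/2\<close> supply a family of separators,
  without which the definition could hold vacuously.\<close>

lemma essential_nonempty:
  assumes "essential S C"
  shows "C \<noteq> {}"
proof -
  have "separates i {r. r i < 1/2} {r. r i > 1/2}" for i
    by (auto simp: separates_def intro!: open_Collect_less continuous_intros)
  then show ?thesis
    using assms[unfolded essential_def, rule_format,
        of "\<lambda>i. {r. r i < 1/2}" "\<lambda>i. {r. r i > 1/2}"] by blast
qed

text \<open>Partitions for the remaining directions are completed by the given ones to a family for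
  all of \<open>S\<close>. This is how directions are spent on shrinking \<open>C\<close>.\<close>

lemma essential_Diff_separators:
  assumes "essential S C" "T \<subseteq> S" "\<And>i. i \<in> T \<Longrightarrow> separates i (U i) (V i)"
  shows "essential (S - T) (C - (\<Union>i\<in>T. U i \<union> V i))"
  unfolding essential_def
proof (intro allI impI)
  fix U' V' assume *: "\<forall>i\<in>S - T. separates i (U' i) (V' i)"
  define U'' V'' where "U'' i = (if i \<in> T then U i else U' i)"
    and "V'' i = (if i \<in> T then V i else V' i)" for i
  have "\<forall>i\<in>S. separates i (U'' i) (V'' i)"
    using * assms by (auto simp: U''_def V''_def)
  then obtain z where "z \<in> C" "\<forall>i\<in>S. z \<notin> U'' i \<union> V'' i"
    using assms(1) unfolding essential_def by blast
  then show "\<exists>z\<in>C - (\<Union>i\<in>T. U i \<union> V i). \<forall>i\<in>S - T. z \<notin> U' i \<union> V' i"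
    using assms(2) by (intro bexI[of _ z]) (auto simp: U''_def V''_def split: if_splits)
qed

lemma essential_mono:
  assumes "essential S C" "C \<subseteq> D"
  shows "essential S D"
  unfolding essential_def
proof (intro allI impI)
  fix U V assume "\<forall>i\<in>S. separates i (U i) (V i)"
  then have "\<exists>z\<in>C. \<forall>i\<in>S. z \<notin> U i \<union> V i"
    using assms(1) unfolding essential_def by (elim allE impE)
  then show "\<exists>z\<in>D. \<forall>i\<in>S. z \<notin> U i \<union> V i"
    using assms(2) by (meson subsetD)
qed

text \<open>The surplus directions are spent on the partitions at the value
  \<open>1/2\<close>.\<close>

lemma essential_antimono:
  assumes "essential S C" "T \<subseteq> S"
  shows "essential T C"
proof -
  define U V where "U i = {r :: nat \<Rightarrow> real. r i < 1/2}" and "V i = {r :: nat \<Rightarrow> real. r i > 1/2}" for i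
  have sep: "separates i (U i) (V i)" for i
    by (auto simp: separates_def U_def V_def intro!: open_Collect_less continuous_intros)
  have "essential (S - (S - T)) (C - (\<Union>i\<in>S - T. U i \<union> V i))"
    using assms(1) sep by (intro essential_Diff_separators) auto
  moreover have "S - (S - T) = T" using assms(2) by blast
  ultimately have "essential T (C - (\<Union>i\<in>S - T. U i \<union> V i))" by simp
  then show ?thesis by (rule essential_mono) (rule Diff_subset)
qed

text \<open>If both parts were inessential, their separators could be glued into one family
  contradicting that \<open>C\<close> is essential.\<close>

lemma essential_disjoint_Un:
  assumes ess: "essential S C" and sub: "C \<subseteq> O1 \<union> O2"
    and opn: "open O1" "open O2" and dis: "O1 \<inter> O2 = {}"
  shows "essential S (C \<inter> O1) \<or> essential S (C \<inter> O2)"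
proof (rule ccontr)
  assume "\<not> ?thesis"
  then have not_ess: "\<not> essential S (C \<inter> O1)" "\<not> essential S (C \<inter> O2)" by simp_all
  obtain U V where U: "\<And>i. i \<in> S \<Longrightarrow> separates i (U i) (V i)"
      "\<And>z. z \<in> C \<inter> O1 \<Longrightarrow> \<exists>i\<in>S. z \<in> U i \<union> V i"
    by (rule not_essentialE[OF not_ess(1)]) blast
  obtain U' V' where U': "\<And>i. i \<in> S \<Longrightarrow> separates i (U' i) (V' i)"
      "\<And>z. z \<in> C \<inter> O2 \<Longrightarrow> \<exists>i\<in>S. z \<in> U' i \<union> V' i"
    by (rule not_essentialE[OF not_ess(2)]) blast
  \<comment> \<open>On \<open>O1\<close> the glued sides are those of the first family, on
    \<open>O2\<close> those of the second. The terms \<open>U i \<inter> U' i\<close> and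
    \<open>V i \<inter> V' i\<close> keep the faces covered outside
    \<open>O1 \<union> O2\<close>.\<close>
  define U'' V'' where "U'' i = U i \<inter> U' i \<union> U i \<inter> O1 \<union> U' i \<inter> O2"
    and "V'' i = V i \<inter> V' i \<union> V i \<inter> O1 \<union> V' i \<inter> O2" for i
  have "separates i (U'' i) (V'' i)" if "i \<in> S" for i
  proof -
    have U_i: "open (U i)" "open (V i)" "U i \<inter> V i = {}" "{r \<in> unit_cube. r i = 0} \<subseteq> U i" "{r \<in> unit_cube. r i = 1} \<subseteq> V i"
      using U(1)[OF that] by (auto simp: separates_def)
    have U'_i: "open (U' i)" "open (V' i)" "U' i \<inter> V' i = {}" "{r \<in> unit_cube. r i = 0} \<subseteq> U' i" "{r \<in> unit_cube. r i = 1} \<subseteq> V' i"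
      using U'(1)[OF that] by (auto simp: separates_def)
    have "open (U'' i)" "open (V'' i)"
      unfolding U''_def V''_def using U_i(1,2) U'_i(1,2) opn by auto
    moreover have "U'' i \<inter> V'' i = {}"
      unfolding U''_def V''_def using U_i(3) U'_i(3) dis by blast
    moreover have "{r \<in> unit_cube. r i = 0} \<subseteq> U'' i" "{r \<in> unit_cube. r i = 1} \<subseteq> V'' i"
      unfolding U''_def V''_def using U_i(4,5) U'_i(4,5) by blast+
    ultimately show ?thesis by (simp add: separates_def)
  qed
  then have "\<exists>z\<in>C. \<forall>i\<in>S. z \<notin> U'' i \<union> V'' i"
    by (intro essentialD[OF ess])
  then obtain z where z: "z \<in> C" "\<forall>i\<in>S. z \<notin> U'' i \<union> V'' i" ..
  from sub z(1) consider "z \<in> C \<inter> O1" | "z \<in> C \<inter> O2" by blast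
  then show False
  proof cases
    case 1
    then obtain i where "i \<in> S" "z \<in> U i \<union> V i" using U(2) by blast
    with 1 z(2) show False unfolding U''_def V''_def by blast
  next
    case 2
    then obtain i where "i \<in> S" "z \<in> U' i \<union> V' i" using U'(2) by blast
    with 2 z(2) show False unfolding U''_def V''_def by blast
  qed
qed

text \<open>For fixed separators, what remains of the \<open>C n\<close> is a decreasing sequence of
  nonempty compact sets.\<close>

lemma essential_INT:
  fixes C :: "nat \<Rightarrow> (nat \<Rightarrow> real) set"
  assumes ess: "\<And>n. essential S (C n)" and comp: "\<And>n. compact (C n)"
    and dec: "\<And>n. C (Suc n) \<subseteq> C n"
  shows "essential S (\<Inter>n. C n)"
  unfolding essential_def
proof (intro allI impI)
  fix U V assume sep: "\<forall>i\<in>S. separates i (U i) (V i)"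
  define D where "D n = C n - (\<Union>i\<in>S. U i \<union> V i)" for n
  have op: "open (\<Union>i\<in>S. U i \<union> V i)"
    using sep unfolding separates_def by (intro open_UN ballI open_Un) auto
  have "compact (D n)" for n
    unfolding D_def by (rule compact_diff[OF comp op])
  moreover have "D n \<noteq> {}" for n
    using ess[of n] sep unfolding D_def essential_def by blast
  moreover have "D (Suc n) \<subseteq> D n" for n
    using dec unfolding D_def by blast
  ultimately have "\<Inter>(range D) \<noteq> {}"
    by (intro compact_nested_nonempty)
  then show "\<exists>z\<in>\<Inter>(range C). \<forall>i\<in>S. z \<notin> U i \<union> V i"
    unfolding D_def by blast
qed

text \<open>The two values of a bit cut \<open>X\<close> into relatively clopen parts. Such parts
  are separated in the whole metric space and hence have disjoint open neighbourhoods there, on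
  which the bit is extended.\<close>

lemma bool_cylinders_disjoint_open:
  fixes g :: "'a::metric_space \<Rightarrow> nat \<Rightarrow> bool"
  assumes "continuous_on X g"
  obtains P N where "open P" "open N" "P \<inter> N = {}"
    "\<And>z. z \<in> X \<Longrightarrow> g z b \<Longrightarrow> z \<in> P" "\<And>z. z \<in> X \<Longrightarrow> \<not> g z b \<Longrightarrow> z \<in> N"
proof -
  have cont: "continuous_on X (\<lambda>z. g z b)"
    by (rule continuous_on_product_then_coordinatewise[OF assms])
  have op: "openin (top_of_set X) {z \<in> X. g z b = c}" for c
    using continuous_openin_preimage_gen[OF cont, of "{c}"] open_discrete[of "{c}"]
    by (simp add: vimage_def Int_def)
  let ?S = "{z \<in> X. g z b = True}" and ?T = "{z \<in> X. g z b = False}"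
  have X: "?S \<union> ?T = X" "X - ?S = ?T" "X - ?T = ?S" by auto
  have "closedin (top_of_set X) ?T" "closedin (top_of_set X) ?S"
    using closedin_diff[OF closedin_topspace op[of True]] closedin_diff[OF closedin_topspace op[of False]] X(2,3)
    by simp_all
  then have "separatedin (top_of_set X) ?S ?T"
    by (auto simp: separatedin_closed_sets disjnt_def)
  then have "separatedin euclidean ?S ?T"
    by (simp add: separatedin_subtopology)
  then obtain P N where "open P" "open N" "?S \<subseteq> P" "?T \<subseteq> N" "disjnt P N"
    using metrizable_space_separation[OF metrizable_space_euclidean, of ?S ?T] by auto
  then show thesis
    by (intro that[of P N]) (auto simp: disjnt_def)
qed

text \<open>The blocks give every bit of a map into Cantor space its own supply of
  directions.\<close>

lemma infinite_split:
  assumes "infinite (S :: nat set)"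
  obtains T where "\<And>b::nat. infinite (T b)" "\<And>b. T b \<subseteq> S" "\<And>a b. a \<noteq> b \<Longrightarrow> T a \<inter> T b = {}"
proof -
  define f where "f b n = enumerate S (prod_encode (b, n))" for b n
  have inj: "f b n = f b' n' \<Longrightarrow> b = b' \<and> n = n'" for b n b' n'
    using strict_mono_eq[OF strict_mono_enumerate[OF assms]] unfolding f_def by simp
  show thesis
  proof (rule that[of "\<lambda>b. range (f b)"])
    show "infinite (range (f b))" for b
      by (rule range_inj_infinite) (rule injI, drule inj, simp)
    show "range (f b) \<subseteq> S" for b
      unfolding f_def using enumerate_in_set[OF assms] by (rule image_subsetI)
    show "range (f a) \<inter> range (f b) = {}" if "a \<noteq> b" for a b
    proof (rule ccontr)
      assume "range (f a) \<inter> range (f b) \<noteq> {}"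
      then obtain n n' where "f a n = f b n'" by (metis disjoint_iff rangeE)
      with inj that show False by blast
    qed
  qed
qed

text \<open>Direction \<open>i\<close> is spent on the slice \<open>r i = a\<close>, where
  \<open>a\<close> lies strictly between 0 and 1 and differs from \<open>p i\<close>.\<close>

lemma essential_avoid_point:
  assumes "essential S C" "compact C" "i \<in> S"
  obtains C' where "C' \<subseteq> C" "compact C'" "essential (S - {i}) C'" "p \<notin> C'"
proof -
  define a :: real where "a = (if p i = 1/2 then 1/3 else 1/2)"
  define U V where "U = {r. r i < a}" and "V = {r. r i > a}"
  have a: "0 < a" "a < 1" "p i \<noteq> a" by (auto simp: a_def)
  have op: "open U" "open V"
    unfolding U_def V_def by (auto intro!: open_Collect_less continuous_intros)
  then have sep: "separates i U V"
    using a unfolding separates_def U_def V_def by auto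
  show thesis
  proof (rule that)
    show "compact (C - (U \<union> V))"
      using assms(2) op by (intro compact_diff open_Un)
    show "essential (S - {i}) (C - (U \<union> V))"
      using essential_Diff_separators[OF assms(1), of "{i}" "\<lambda>_. U" "\<lambda>_. V"] assms(3) sep by auto
    show "p \<notin> C - (U \<union> V)"
      using a by (auto simp: U_def V_def)
  qed blast
qed

text \<open>Bits are fixed one at a time, always keeping an essential half:
  \<open>essential_disjoint_Un\<close> supplies it, and \<open>essential_INT\<close> passes to the
  limit.\<close>

lemma essential_fibre:
  assumes ess: "essential S C" and comp: "compact C"
    and opn: "\<And>b. open (P b)" "\<And>b. open (N b)" and dis: "\<And>b. P b \<inter> N b = {}"
    and cov: "\<And>b. C \<subseteq> P b \<union> N b"
  obtains x where "essential S {z \<in> C. \<forall>b::nat. z \<in> P b \<longleftrightarrow> x b}"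
    "compact {z \<in> C. \<forall>b::nat. z \<in> P b \<longleftrightarrow> x b}"
proof -
  define half where "half b E = (if essential S (E \<inter> P b) then E \<inter> P b else E \<inter> N b)" for b E
  define E where "E = rec_nat C half"
  have E_simps: "E 0 = C" "E (Suc b) = half b (E b)" for b by (simp_all add: E_def)
  \<comment> \<open>Inside \<open>C\<close>, meeting one open half is the same as removing the
    other, so compactness is kept.\<close>
  have half_alt: "half b F = F - N b \<or> half b F = F - P b" if "F \<subseteq> C" for b F
    using subset_trans[OF that cov[of b]] dis[of b] unfolding half_def by (cases "essential S (F \<inter> P b)") (simp_all, blast+)
  have *: "essential S (E b) \<and> compact (E b) \<and> E b \<subseteq> C" for b
  proof (induction b)
    case 0
    show ?case using ess comp by (simp add: E_simps)
  next
    case (Suc b)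
    have "essential S (half b (E b))"
    proof -
      have "E b \<subseteq> P b \<union> N b" using Suc cov[of b] by blast
      then have "essential S (E b \<inter> P b) \<or> essential S (E b \<inter> N b)"
        using Suc opn dis by (intro essential_disjoint_Un) auto
      then show ?thesis unfolding half_def by auto
    qed
    moreover have "compact (half b (E b))"
    proof -
      have "half b (E b) = E b - N b \<or> half b (E b) = E b - P b" using half_alt Suc by blast
      then show ?thesis using Suc opn compact_diff[of "E b"] by auto
    qed
    moreover have "half b (E b) \<subseteq> C" using Suc unfolding half_def by auto
    ultimately show ?case by (simp add: E_simps)
  qed
  have dec: "E (Suc b) \<subseteq> E b" for b by (auto simp: E_simps half_def)
  define x where "x b \<longleftrightarrow> essential S (E b \<inter> P b)" for b
  have x: "z \<in> P b \<longleftrightarrow> x b" if "z \<in> E (Suc b)" for z b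
  proof -
    have "z \<in> (if x b then E b \<inter> P b else E b \<inter> N b)"
      using that unfolding E_simps half_def x_def by simp
    then show ?thesis using dis[of b] by (cases "x b") auto
  qed
  have "(\<Inter>b. E b) = {z \<in> C. \<forall>b. z \<in> P b \<longleftrightarrow> x b}" (is "?L = ?R")
  proof
    show "?L \<subseteq> ?R"
    proof
      fix z assume "z \<in> ?L"
      then have "z \<in> E b" for b by blast
      then show "z \<in> ?R" using x E_simps(1) by blast
    qed
    have "z \<in> E b" if "z \<in> ?R" for z b
    proof (induction b)
      case 0 then show ?case using that by (simp add: E_simps)
    next
      case (Suc b)
      have "z \<in> P b \<union> N b" using that cov[of b] by blast
      with Suc that have "z \<in> (if x b then E b \<inter> P b else E b \<inter> N b)"
        by (cases "x b") auto
      then show ?case unfolding E_simps half_def x_def by simp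
    qed
    then show "?R \<subseteq> ?L" by blast
  qed
  moreover have "essential S (\<Inter>b. E b)"
    by (rule essential_INT) (use * dec in auto)
  moreover have "compact (\<Inter>b. E b)"
  proof -
    have "closed (\<Inter>b. E b)" using * compact_imp_closed by blast
    moreover have "(\<Inter>b. E b) = C \<inter> (\<Inter>b. E b)" using * by blast
    ultimately show ?thesis using compact_Int_closed[OF comp] by metis
  qed
  ultimately show thesis using that[of x] by simp
qed

text \<open>Injectivity of \<open>g\<close> serves the last move: the essential fibre meets
  \<open>X\<close> in at most one point, and one more direction removes that point.\<close>

lemma essential_avoid:
  fixes g :: "(nat \<Rightarrow> real) \<Rightarrow> nat \<Rightarrow> bool"
  assumes cont: "continuous_on X g" and inj: "inj_on g X"
    and S: "infinite S" and ess: "essential S C" and comp: "compact C"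
  obtains S' C' where "infinite S'" "essential S' C'" "compact C'" "C' \<subseteq> C" "C' \<inter> X = {}"
proof -
  have "\<exists>p. open (fst p) \<and> open (snd p) \<and> fst p \<inter> snd p = {} \<and>
      (\<forall>z\<in>X. g z b \<longrightarrow> z \<in> fst p) \<and> (\<forall>z\<in>X. \<not> g z b \<longrightarrow> z \<in> snd p)" for b
  proof -
    obtain P N where "open P" "open N" "P \<inter> N = {}"
      "\<And>z. z \<in> X \<Longrightarrow> g z b \<Longrightarrow> z \<in> P" "\<And>z. z \<in> X \<Longrightarrow> \<not> g z b \<Longrightarrow> z \<in> N"
      by (rule bool_cylinders_disjoint_open[OF cont, of b]) blast
    then show ?thesis by (intro exI[of _ "(P, N)"]) simp
  qed
  then obtain p where p: "\<And>b. open (fst (p b)) \<and> open (snd (p b)) \<and> fst (p b) \<inter> snd (p b) = {} \<and>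
      (\<forall>z\<in>X. g z b \<longrightarrow> z \<in> fst (p b)) \<and> (\<forall>z\<in>X. \<not> g z b \<longrightarrow> z \<in> snd (p b))"
    by metis
  define P N where "P b = fst (p b)" and "N b = snd (p b)" for b
  have opn: "\<And>b. open (P b)" "\<And>b. open (N b)" and dis: "\<And>b. P b \<inter> N b = {}"
    and P: "\<And>b z. z \<in> X \<Longrightarrow> g z b \<Longrightarrow> z \<in> P b" and N: "\<And>b z. z \<in> X \<Longrightarrow> \<not> g z b \<Longrightarrow> z \<in> N b"
    using p unfolding P_def N_def by simp_all
  \<comment> \<open>The part of \<open>C\<close> where the extension of bit \<open>b\<close> is
    undefined.\<close>
  define D where "D b = C - (P b \<union> N b)" for b
  have D_comp: "compact (D b)" for b
    unfolding D_def by (intro compact_diff open_Un comp opn)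
  have D_X: "D b \<inter> X = {}" for b
    using P N unfolding D_def by blast
  \<comment> \<open>\<open>T (Suc b)\<close> is reserved for bit \<open>b\<close>, and
    \<open>T 0\<close> is the infinite supply that survives.\<close>
  obtain T where T: "\<And>b::nat. infinite (T b)" "\<And>b. T b \<subseteq> S" "\<And>a b. a \<noteq> b \<Longrightarrow> T a \<inter> T b = {}"
    using infinite_split[OF S] by metis
  show thesis
  proof (cases "\<exists>b. essential (T (Suc b)) (D b)")
    case True
    then obtain b where "essential (T (Suc b)) (D b)" ..
    then show thesis
      using that[of "T (Suc b)" "D b"] T(1) D_comp D_X D_def by blast
  next
    case False
    have "\<exists>p. (\<forall>i\<in>T (Suc b). separates i (fst p i) (snd p i)) \<and>
        (\<forall>z\<in>D b. \<exists>i\<in>T (Suc b). z \<in> fst p i \<union> snd p i)" for b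
    proof -
      obtain U V where "\<And>i. i \<in> T (Suc b) \<Longrightarrow> separates i (U i) (V i)"
        "\<And>z. z \<in> D b \<Longrightarrow> \<exists>i\<in>T (Suc b). z \<in> U i \<union> V i"
        by (rule not_essentialE[of "T (Suc b)" "D b"]) (use False in blast)+
      then show ?thesis by (intro exI[of _ "(U, V)"]) simp
    qed
    then obtain q where q: "\<And>b. (\<forall>i\<in>T (Suc b). separates i (fst (q b) i) (snd (q b) i)) \<and>
        (\<forall>z\<in>D b. \<exists>i\<in>T (Suc b). z \<in> fst (q b) i \<union> snd (q b) i)"
      by metis
    define U V where "U b = fst (q b)" and "V b = snd (q b)" for b
    have sep: "\<And>b i. i \<in> T (Suc b) \<Longrightarrow> separates i (U b i) (V b i)"
      and D_cov: "\<And>b z. z \<in> D b \<Longrightarrow> \<exists>i\<in>T (Suc b). z \<in> U b i \<union> V b i"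
      using q unfolding U_def V_def by blast+
    define T' where "T' = (\<Union>b. T (Suc b))"
    \<comment> \<open>The blocks are disjoint, so a spent direction determines its bit. This merges
      the separators of all bits into one family.\<close>
    define blk where "blk i = (THE b. i \<in> T (Suc b))" for i
    have blk: "blk i = b" if "i \<in> T (Suc b)" for i b
      unfolding blk_def
    proof (rule the_equality)
      show "i \<in> T (Suc b)" by (rule that)
      fix a assume "i \<in> T (Suc a)"
      then show "a = b" using that T(3)[of "Suc a" "Suc b"] by blast
    qed
    define O' where "O' = (\<Union>i\<in>T'. U (blk i) i \<union> V (blk i) i)"
    have sep': "separates i (U (blk i) i) (V (blk i) i)" if "i \<in> T'" for i
      using that sep blk unfolding T'_def by auto
    have "open O'"
      using sep' unfolding O'_def separates_def by (intro open_UN ballI open_Un) auto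
    then have comp1: "compact (C - O')"
      by (rule compact_diff[OF comp])
    have "essential (S - T') (C - O')"
      unfolding O'_def using T(2) sep' by (intro essential_Diff_separators[OF ess]) (auto simp: T'_def)
    moreover have "T 0 \<subseteq> S - T'"
      using T(2) T(3)[of 0] unfolding T'_def by blast
    ultimately have ess1: "essential (T 0) (C - O')"
      by (rule essential_antimono)
    \<comment> \<open>Every undefined region is cut away, so each extended bit is defined on all of
      \<open>C - O'\<close>.\<close>
    have "D b \<subseteq> O'" for b
      using D_cov[of _ b] blk unfolding O'_def T'_def by fastforce
    then have "C - O' \<subseteq> P b \<union> N b" for b
      unfolding D_def by blast
    then obtain x where ess2: "essential (T 0) {z \<in> C - O'. \<forall>b. z \<in> P b \<longleftrightarrow> x b}" (is "essential _ ?F")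
      and comp2: "compact {z \<in> C - O'. \<forall>b. z \<in> P b \<longleftrightarrow> x b}"
      by (rule essential_fibre[OF ess1 comp1 opn dis])
    have "g z = x" if "z \<in> ?F \<inter> X" for z
    proof
      fix b
      have "z \<in> P b \<longleftrightarrow> x b" "z \<in> X" using that by auto
      then show "g z b = x b" using P[of z b] N[of z b] dis[of b] by auto
    qed
    then have "\<exists>p. ?F \<inter> X \<subseteq> {p}"
      using inj_onD[OF inj] by (metis (no_types, lifting) IntD2 insertI1 subsetI)
    then obtain p where p: "?F \<inter> X \<subseteq> {p}" ..
    have "T 0 \<noteq> {}" using T(1)[of 0] by auto
    then obtain i where i: "i \<in> T 0" by blast
    obtain C' where C': "C' \<subseteq> ?F" "compact C'" "essential (T 0 - {i}) C'" "p \<notin> C'"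
      by (rule essential_avoid_point[OF ess2 comp2 i])
    show thesis
      by (rule that[of "T 0 - {i}" C']) (use C' p T(1)[of 0] in auto)
  qed
qed

text \<open>A Baire-type argument. Infinitely many directions are carried along so that the next set
  can be avoided; of the limit only nonemptiness is asked, which compactness gives.\<close>

lemma unit_cube_not_Union_injective:
  fixes g :: "nat \<Rightarrow> (nat \<Rightarrow> real) \<Rightarrow> nat \<Rightarrow> bool"
  assumes cont: "\<And>n. continuous_on (X n) (g n)" and inj: "\<And>n. inj_on (g n) (X n)"
  shows "\<not> unit_cube \<subseteq> (\<Union>n. X n)"
proof -
  define ok where "ok p \<longleftrightarrow> infinite (fst p) \<and> essential (fst p) (snd p) \<and> compact (snd p)"
    for p :: "nat set \<times> (nat \<Rightarrow> real) set"
  have "\<exists>p'. ok p' \<and> snd p' \<subseteq> snd p \<and> snd p' \<inter> X n = {}" if "ok p" for p n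
  proof -
    obtain S' C' where "infinite S'" "essential S' C'" "compact C'" "C' \<subseteq> snd p" "C' \<inter> X n = {}"
      using essential_avoid[OF cont inj, of "fst p" "snd p" n] \<open>ok p\<close> unfolding ok_def by metis
    then show ?thesis by (intro exI[of _ "(S', C')"]) (auto simp: ok_def)
  qed
  moreover have "ok (UNIV, unit_cube)"
    using essential_unit_cube compact_unit_cube by (simp add: ok_def)
  ultimately have "\<exists>p. \<forall>n. (ok (p n) \<and> (n = 0 \<longrightarrow> p n = (UNIV, unit_cube))) \<and>
      (snd (p (Suc n)) \<subseteq> snd (p n) \<and> snd (p (Suc n)) \<inter> X n = {})"
    by (intro dependent_nat_choice) blast+
  then obtain p where p: "\<And>n. ok (p n)" "\<And>n. snd (p (Suc n)) \<subseteq> snd (p n) \<and> snd (p (Suc n)) \<inter> X n = {}"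
    and p0: "p 0 = (UNIV, unit_cube)" by blast
  have "\<Inter>(range (\<lambda>n. snd (p n))) \<noteq> {}"
  proof (rule compact_nested_nonempty)
    show "compact (snd (p n))" "snd (p n) \<noteq> {}" for n
      using p(1)[of n] essential_nonempty by (auto simp: ok_def)
    show "snd (p (Suc n)) \<subseteq> snd (p n)" for n
      using p(2) by blast
  qed
  then obtain z where z: "\<And>n. z \<in> snd (p n)" by blast
  then have "z \<in> unit_cube" using p0 by (metis snd_conv)
  moreover have "z \<notin> X n" for n using z[of "Suc n"] p(2)[of n] by blast
  ultimately show ?thesis by blast
qed


section \<open>Computable functions\<close>

text \<open>The equivalence contains both termination and uniqueness of the result, so
  \<open>computes p x y\<close> can be replaced by an equation.\<close>

definition computable :: "(nat \<Rightarrow> nat) \<Rightarrow> bool" where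
  "computable f \<longleftrightarrow> (\<exists>p. \<forall>x y. computes p x y \<longleftrightarrow> y = f x)"

inductive_cases computes_PZeroE: "computes PZero x y"
inductive_cases computes_PSuccE: "computes PSucc x y"
inductive_cases computes_PFstE: "computes PFst x y"
inductive_cases computes_PSndE: "computes PSnd x y"
inductive_cases computes_PPairE: "computes (PPair p q) x y"
inductive_cases computes_PCompE: "computes (PComp p q) x y"
inductive_cases computes_PRecE: "computes (PRec p q) x y"
inductive_cases computes_PMinE: "computes (PMin p) x y"

abbreviation "pfst x \<equiv> fst (prod_decode x)"
abbreviation "psnd x \<equiv> snd (prod_decode x)"

lemma computable_cong: "computable f \<Longrightarrow> (\<And>x. f x = g x) \<Longrightarrow> computable g"
  by (simp add: computable_def)

lemma computable_0: "computable (\<lambda>x. 0)"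
  unfolding computable_def by (rule exI[of _ PZero]) (auto intro: computes.zero elim: computes_PZeroE)

lemma computable_comp: "computable f \<Longrightarrow> computable g \<Longrightarrow> computable (\<lambda>x. f (g x))"
proof -
  assume "computable f" "computable g"
  then obtain p q where "\<And>x y. computes p x y \<longleftrightarrow> y = f x" "\<And>x y. computes q x y \<longleftrightarrow> y = g x"
    unfolding computable_def by blast
  then have "\<forall>x y. computes (PComp p q) x y \<longleftrightarrow> y = f (g x)"
    by (auto intro: computes.comp elim: computes_PCompE)
  then show ?thesis unfolding computable_def by blast
qed

lemma computable_Suc_fun: "computable Suc"
  unfolding computable_def by (rule exI[of _ PSucc]) (auto intro: computes.succ elim: computes_PSuccE)

lemma computable_Suc: "computable f \<Longrightarrow> computable (\<lambda>x. Suc (f x))"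
  by (rule computable_comp[OF computable_Suc_fun])

lemma computable_pfst: "computable f \<Longrightarrow> computable (\<lambda>x. pfst (f x))"
proof -
  have "computes PFst x y \<longleftrightarrow> y = pfst x" for x y
    using computes.fst[of "pfst x" "psnd x"] by (auto elim: computes_PFstE)
  then have "computable pfst" unfolding computable_def by blast
  then show "computable f \<Longrightarrow> computable (\<lambda>x. pfst (f x))" by (rule computable_comp)
qed

lemma computable_psnd: "computable f \<Longrightarrow> computable (\<lambda>x. psnd (f x))"
proof -
  have "computes PSnd x y \<longleftrightarrow> y = psnd x" for x y
    using computes.snd[of "pfst x" "psnd x"] by (auto elim: computes_PSndE)
  then have "computable psnd" unfolding computable_def by blast
  then show "computable f \<Longrightarrow> computable (\<lambda>x. psnd (f x))" by (rule computable_comp)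
qed

lemma computable_pair: "computable f \<Longrightarrow> computable g \<Longrightarrow> computable (\<lambda>x. prod_encode (f x, g x))"
proof -
  assume "computable f" "computable g"
  then obtain p q where "\<And>x y. computes p x y \<longleftrightarrow> y = f x" "\<And>x y. computes q x y \<longleftrightarrow> y = g x"
    unfolding computable_def by blast
  then have "\<forall>x y. computes (PPair p q) x y \<longleftrightarrow> y = prod_encode (f x, g x)"
    by (auto intro: computes.pair elim: computes_PPairE)
  then show ?thesis unfolding computable_def by blast
qed

lemma computable_id: "computable (\<lambda>x. x)"
proof -
  have "computes (PPair PFst PSnd) x y \<longleftrightarrow> y = x" for x y
  proof
    assume "computes (PPair PFst PSnd) x y"
    then show "y = x" by (elim computes_PPairE computes_PFstE computes_PSndE) auto
  next
    assume "y = x"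
    then show "computes (PPair PFst PSnd) x y"
      using computes.pair[OF computes.fst[of "pfst x" "psnd x"] computes.snd] by auto
  qed
  then show ?thesis unfolding computable_def by blast
qed

lemma computable_rec_0:
  assumes "computable f" "computable g"
  shows "computable (\<lambda>x. rec_nat (f (pfst x)) (\<lambda>n y. g (prod_encode (pfst x, prod_encode (n, y)))) (psnd x))"
proof -
  obtain p q where p: "\<And>x y. computes p x y \<longleftrightarrow> y = f x" and q: "\<And>x y. computes q x y \<longleftrightarrow> y = g x"
    using assms unfolding computable_def by blast
  have "computes (PRec p q) (prod_encode (a, n)) y \<longleftrightarrow>
      y = rec_nat (f a) (\<lambda>n y. g (prod_encode (a, prod_encode (n, y)))) n" for a n y
  proof (induction n arbitrary: y)
    case 0
    show ?case using p computes.rec_0[of p a y q] by (auto elim: computes_PRecE)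
  next
    case (Suc n)
    have "computes (PRec p q) (prod_encode (a, Suc n)) y \<longleftrightarrow>
        (\<exists>y'. computes (PRec p q) (prod_encode (a, n)) y' \<and> computes q (prod_encode (a, prod_encode (n, y'))) y)"
      (is "?L \<longleftrightarrow> ?R")
    proof
      assume ?L then show ?R by (rule computes_PRecE) auto
    next
      assume ?R then show ?L by (blast intro: computes.rec_Suc)
    qed
    then show ?case by (simp add: Suc q)
  qed
  then have "computes (PRec p q) x y \<longleftrightarrow>
      y = rec_nat (f (pfst x)) (\<lambda>n y. g (prod_encode (pfst x, prod_encode (n, y)))) (psnd x)" for x y
    by (metis prod.collapse prod_decode_inverse)
  then show ?thesis unfolding computable_def by blast
qed

lemma computable_rec:
  assumes "computable f" "computable g" "computable h"
  shows "computable (\<lambda>x. rec_nat (f x) (\<lambda>n y. g (prod_encode (x, prod_encode (n, y)))) (h x))"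
  using computable_comp[OF computable_rec_0[OF assms(1,2)] computable_pair[OF computable_id assms(3)]]
  by simp

text \<open>\<open>PMin\<close> stops at the least zero if there is one; since \<open>f\<close> is
  total, all earlier tests return a value.\<close>

lemma computable_search:
  assumes "computable f"
  shows "\<exists>p. \<forall>x. (\<exists>y. computes p x y) \<longleftrightarrow> (\<exists>w. f (prod_encode (x, w)) = 0)"
proof -
  obtain p where p: "\<And>x y. computes p x y \<longleftrightarrow> y = f x"
    using assms unfolding computable_def by blast
  have "(\<exists>y. computes (PMin p) x y) \<longleftrightarrow> (\<exists>w. f (prod_encode (x, w)) = 0)" for x
  proof
    assume "\<exists>y. computes (PMin p) x y"
    then show "\<exists>w. f (prod_encode (x, w)) = 0"
      using p by (auto elim!: computes_PMinE)
  next
    assume *: "\<exists>w. f (prod_encode (x, w)) = 0"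
    define n where "n = (LEAST w. f (prod_encode (x, w)) = 0)"
    have "f (prod_encode (x, n)) = 0" unfolding n_def by (rule LeastI_ex[OF *])
    moreover have "\<exists>y. Suc y = f (prod_encode (x, m))" if "m < n" for m
      using not_less_Least[OF that[unfolded n_def]] by (metis not0_implies_Suc)
    ultimately have "computes (PMin p) x n"
      using p by (intro computes.min) auto
    then show "\<exists>y. computes (PMin p) x y" ..
  qed
  then show ?thesis by blast
qed

lemma computable_const: "computable (\<lambda>x. c)"
  by (induction c) (auto intro: computable_0 computable_Suc)

text \<open>The step function is curried here, so that the rule applies to recursions as they are
  usually written.\<close>

lemma computable_rec_nat:
  assumes "computable f" "computable h"
    and "computable (\<lambda>x. g (pfst x) (pfst (psnd x)) (psnd (psnd x)))"
  shows "computable (\<lambda>x. rec_nat (f x) (g x) (h x))"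
  using computable_rec[OF assms(1,3,2)] by simp

section \<open>Closure properties of computable functions and decidable predicates\<close>

named_theorems computable_intros
lemmas [computable_intros] = computable_id computable_const computable_Suc computable_pfst computable_psnd
  computable_pair

lemma computable_add [computable_intros]:
  assumes "computable f" "computable g"
  shows "computable (\<lambda>x. f x + g x)"
proof -
  have "rec_nat a (\<lambda>n y. Suc y) n = a + n" for a n by (induction n) simp_all
  moreover have "computable (\<lambda>x. rec_nat (f x) (\<lambda>n y. Suc y) (g x))"
    by (intro computable_rec_nat computable_intros assms)
  ultimately show ?thesis by (elim computable_cong)
qed

lemma computable_pred:
  assumes "computable f"
  shows "computable (\<lambda>x. f x - 1)"
proof -
  have "rec_nat 0 (\<lambda>n y. n) m = m - 1" for m by (cases m) simp_all
  moreover have "computable (\<lambda>x. rec_nat 0 (\<lambda>n y. n) (f x))"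
    by (intro computable_rec_nat computable_intros assms)
  ultimately show ?thesis by (elim computable_cong)
qed

lemma computable_diff [computable_intros]:
  assumes "computable f" "computable g"
  shows "computable (\<lambda>x. f x - g x)"
proof -
  have "rec_nat a (\<lambda>n y. y - 1) n = a - n" for a n :: nat by (induction n) simp_all
  moreover have "computable (\<lambda>x. rec_nat (f x) (\<lambda>n y. y - 1) (g x))"
    by (intro computable_rec_nat computable_pred computable_intros assms)
  ultimately show ?thesis by (elim computable_cong)
qed

lemma computable_mult [computable_intros]:
  assumes "computable f" "computable g"
  shows "computable (\<lambda>x. f x * g x)"
proof -
  have "rec_nat 0 (\<lambda>n y. y + a) n = a * n" for a n :: nat by (induction n) simp_all
  moreover have "computable (\<lambda>x. rec_nat 0 (\<lambda>n y. y + f x) (g x))"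
    by (intro computable_rec_nat computable_intros assms computable_comp[OF assms(1)])
  ultimately show ?thesis by (elim computable_cong)
qed

lemma computable_power [computable_intros]:
  assumes "computable f" "computable g"
  shows "computable (\<lambda>x. f x ^ g x)"
proof -
  have "rec_nat 1 (\<lambda>n y. y * a) n = a ^ n" for a n :: nat by (induction n) simp_all
  moreover have "computable (\<lambda>x. rec_nat 1 (\<lambda>n y. y * f x) (g x))"
    by (intro computable_rec_nat computable_intros assms computable_comp[OF assms(1)])
  ultimately show ?thesis by (elim computable_cong)
qed

text \<open>Truth is coded by 0 because \<open>PMin\<close> searches for zeros.\<close>

definition decidable :: "(nat \<Rightarrow> bool) \<Rightarrow> bool" where
  "decidable P \<longleftrightarrow> computable (\<lambda>x. if P x then 0 else 1)"

lemma decidable_search: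
  assumes "decidable P"
  shows "\<exists>p. \<forall>x. (\<exists>y. computes p x y) \<longleftrightarrow> (\<exists>w. P (prod_encode (x, w)))"
proof -
  have "(\<exists>w. (if P (prod_encode (x, w)) then 0 else 1) = (0::nat)) \<longleftrightarrow> (\<exists>w. P (prod_encode (x, w)))" for x
    by simp
  then show ?thesis
    using computable_search[OF assms[unfolded decidable_def]] by (simp only:)
qed

lemma decidable_le [computable_intros]:
  assumes "computable f" "computable g"
  shows "decidable (\<lambda>x. f x \<le> g x)"
proof -
  \<comment> \<open>Subtraction on naturals truncates at 0, so this is the sign of
    \<open>f x - g x\<close>.\<close>
  have "computable (\<lambda>x. 1 - (1 - (f x - g x)))" by (intro computable_intros assms)
  then show ?thesis unfolding decidable_def by (rule computable_cong) auto
qed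

lemma decidable_conj [computable_intros]:
  assumes "decidable P" "decidable R"
  shows "decidable (\<lambda>x. P x \<and> R x)"
proof -
  have "computable (\<lambda>x. 1 - (1 - ((if P x then 0 else 1) + (if R x then 0 else 1))))"
    by (intro computable_intros assms[unfolded decidable_def])
  then show ?thesis unfolding decidable_def by (rule computable_cong) auto
qed

lemma decidable_eq [computable_intros]:
  assumes "computable f" "computable g"
  shows "decidable (\<lambda>x. f x = g x)"
proof -
  have "decidable (\<lambda>x. f x \<le> g x \<and> g x \<le> f x)"
    by (intro computable_intros assms)
  then show ?thesis by (simp only: order_eq_iff[symmetric])
qed

lemma computable_If [computable_intros]:
  assumes "decidable P" "computable f" "computable g"
  shows "computable (\<lambda>x. if P x then f x else g x)"
proof -
  have "computable (\<lambda>x. f x * (1 - (if P x then 0 else 1)) + g x * (if P x then 0 else 1))"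
    by (intro computable_intros assms assms(1)[unfolded decidable_def])
  then show ?thesis by (rule computable_cong) auto
qed

lemma decidable_all_less [computable_intros]:
  assumes "computable f" and P: "decidable (\<lambda>x. P (pfst x) (psnd x))"
  shows "decidable (\<lambda>x. \<forall>j<f x. P x j)"
proof -
  \<comment> \<open>The accumulator stays 0 until a counterexample is met.\<close>
  have "rec_nat 0 (\<lambda>n y. if y = 0 \<and> P x n then 0 else 1) m = (if \<forall>j<m. P x j then 0 else 1::nat)" for x m
    by (induction m) (auto simp: less_Suc_eq)
  moreover have "decidable (\<lambda>x. P (pfst x) (pfst (psnd x)))"
  proof -
    have "computable (\<lambda>x. prod_encode (pfst x, pfst (psnd x)))" by (intro computable_intros)
    from computable_comp[OF P[unfolded decidable_def] this] show ?thesis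
      unfolding decidable_def by simp
  qed
  then have "computable (\<lambda>x. rec_nat 0 (\<lambda>n y. if y = 0 \<and> P x n then 0 else 1) (f x))"
    by (intro computable_rec_nat computable_intros assms(1))
  ultimately show ?thesis unfolding decidable_def by simp
qed

text \<open>The quotient is updated while the dividend counts up, since it grows by at most one at
  each step.\<close>

lemma computable_div [computable_intros]:
  assumes "computable f" "computable g" "\<And>x. g x \<noteq> 0"
  shows "computable (\<lambda>x. f x div g x)"
proof -
  have *: "rec_nat 0 (\<lambda>n y. if Suc y * b \<le> Suc n then Suc y else y) m = m div b" if "b \<noteq> 0" for m b :: nat
  proof (induction m)
    case (Suc m)
    have "Suc m div b = (if Suc (m div b) * b \<le> Suc m then Suc (m div b) else m div b)"
    proof (cases "Suc (m div b) * b \<le> Suc m")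
      case True
      then have "Suc (m div b) \<le> Suc m div b" using that by (simp add: less_eq_div_iff_mult_less_eq)
      moreover have "Suc m div b \<le> Suc (m div b)" by (simp add: div_Suc)
      ultimately show ?thesis using True by simp
    next
      case False
      then have "\<not> Suc (m div b) \<le> Suc m div b" using that by (simp add: less_eq_div_iff_mult_less_eq)
      moreover have "m div b \<le> Suc m div b" by (simp add: div_le_mono)
      ultimately have "Suc m div b = m div b" by linarith
      then show ?thesis using False by simp
    qed
    then show ?case using Suc by simp
  qed simp
  have "computable (\<lambda>x. rec_nat 0 (\<lambda>n y. if Suc y * g x \<le> Suc n then Suc y else y) (f x))"
    by (intro computable_rec_nat computable_intros assms(1) computable_comp[OF assms(2)])
  then show ?thesis using * assms(3) by simp
qed

lemma computable_mod [computable_intros]: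
  assumes "computable f" "computable g" "\<And>x. g x \<noteq> 0"
  shows "computable (\<lambda>x. f x mod g x)"
  using computable_diff[OF assms(1) computable_mult[OF computable_div[OF assms] assms(2)]]
  by (simp add: minus_div_mult_eq_mod)

lemma computable_take_bit [computable_intros]:
  assumes "computable f" "computable g"
  shows "computable (\<lambda>x. take_bit (f x) (g x))"
  unfolding take_bit_eq_mod by (intro computable_intros assms) simp

lemma decidable_bit [computable_intros]:
  assumes "computable f" "computable g"
  shows "decidable (\<lambda>x. bit (f x) (g x))"
  unfolding bit_iff_odd odd_iff_mod_2_eq_one by (intro computable_intros assms) simp_all

lemma computable_tuple_nth [computable_intros]:
  assumes "computable f" "computable g"
  shows "computable (\<lambda>x. pfst ((psnd ^^ f x) (g x)))"
proof -
  have "rec_nat a (\<lambda>n. psnd) m = (psnd ^^ m) a" for a m by (induction m) simp_all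
  moreover have "computable (\<lambda>x. pfst (rec_nat (g x) (\<lambda>n y. psnd y) (f x)))"
    by (intro computable_rec_nat computable_intros assms)
  ultimately show ?thesis by (elim computable_cong) (simp only:)
qed

text \<open>Entry \<open>j\<close> does not depend on the length \<open>k\<close>, so coordinates
  can be read off the code alone.\<close>

lemma nth_tuple_decode: "j < k \<Longrightarrow> tuple_decode k n ! j = pfst ((psnd ^^ j) n)"
  by (induction k arbitrary: n j) (auto simp: nth_Cons funpow_Suc_right simp del: funpow.simps(2) split: prod.splits nat.split)

lemma length_tuple_decode: "length (tuple_decode k n) = k"
  by (induction k arbitrary: n) (auto split: prod.splits)


section \<open>A selecting left-CEA operator\<close>

lemma computable_min [computable_intros]:
  assumes "computable f" "computable g"
  shows "computable (\<lambda>x. min (f x) (g x))"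
proof -
  have "computable (\<lambda>x. f x - (f x - g x))" by (intro computable_intros assms)
  then show ?thesis by (rule computable_cong) auto
qed

text \<open>Numerator and denominator are kept apart so that centre coordinates can be compared by
  inequalities of naturals. The clipping is that of \<open>unit_rat_of_code\<close>.\<close>

definition coord_num :: "nat \<Rightarrow> nat \<Rightarrow> nat" where
  "coord_num t j = min (pfst (pfst ((psnd ^^ j) t))) (Suc (psnd (pfst ((psnd ^^ j) t))))"

definition coord_den :: "nat \<Rightarrow> nat \<Rightarrow> nat" where
  "coord_den t j = Suc (psnd (pfst ((psnd ^^ j) t)))"

definition coord :: "nat \<Rightarrow> nat \<Rightarrow> real" where
  "coord t j = unit_rat_of_code (pfst ((psnd ^^ j) t))"

lemma coord_eq: "coord t j = real (coord_num t j) / real (coord_den t j)"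
  by (simp add: coord_def coord_num_def coord_den_def unit_rat_of_code_def case_prod_beta)

lemma coord_den_pos: "coord_den t j > 0"
  by (simp add: coord_den_def)

text \<open>Packs the arguments of a question of the form \<open>excluded\<close> into the oracle
  position that holds its answer.\<close>

definition box_code :: "nat \<Rightarrow> nat \<Rightarrow> nat \<Rightarrow> nat \<Rightarrow> nat \<Rightarrow> nat \<Rightarrow> nat" where
  "box_code k l \<sigma> t' b' n =
     prod_encode (k, prod_encode (l, prod_encode (\<sigma>, prod_encode (t', prod_encode (b', n)))))"

text \<open>
  Membership of the ball \<open>i\<close> in the c.e. set: it is decided from the first bits of the centre \<open>s\<close>
  only, and the bound on the radius makes them agree with the oracle. The bit at position \<open>m\<close> is
  read as the answer of the oracle about the box with centre \<open>t'\<close> and radius \<open>1 / (b' + 1)\<close>, which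
  has to contain the ball. The inequalities between naturals are those between rationals,
  multiplied out.
\<close>

definition accepts :: "nat \<Rightarrow> nat \<Rightarrow> nat \<Rightarrow> nat \<Rightarrow> bool" where
  "accepts k i n w \<longleftrightarrow>
     (let s = pfst (pfst i); t = psnd (pfst i); a = pfst (psnd i); b = psnd (psnd i);
          l = pfst w; t' = pfst (psnd w); b' = psnd (psnd w);
          m = box_code k l (take_bit l s) t' b' n
      in a = 0 \<and> bit s m \<and> 2 ^ m \<le> Suc b \<and>
        (\<forall>j<k.
          coord_num t j * coord_den t' j * Suc b * Suc b' + coord_den t j * coord_den t' j * Suc b'
            \<le> coord_num t' j * coord_den t j * Suc b * Suc b' + coord_den t j * coord_den t' j * Suc b \<and>
          coord_num t' j * coord_den t j * Suc b * Suc b' + coord_den t j * coord_den t' j * Suc b'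
            \<le> coord_num t j * coord_den t' j * Suc b * Suc b' + coord_den t j * coord_den t' j * Suc b))"

lemma fraction_le_iff:
  fixes d d' B B' :: real
  assumes "d > 0" "d' > 0" "B > 0" "B' > 0"
  shows "p * d' * B * B' + d * d' * B' \<le> p' * d * B * B' + d * d' * B \<longleftrightarrow> p / d + 1 / B \<le> p' / d' + 1 / B'"
proof -
  have "p / d + 1 / B = (p * d' * B * B' + d * d' * B') / (d * d' * B * B')"
    using assms by (simp add: field_simps)
  moreover have "p' / d' + 1 / B' = (p' * d * B * B' + d * d' * B) / (d * d' * B * B')"
    using assms by (simp add: field_simps)
  moreover have "d * d' * B * B' > 0"
    using assms by simp
  ultimately show ?thesis
    by (metis divide_le_cancel order_less_asym)
qed

lemma coord_le_iff:
  "coord_num t j * coord_den t' j * Suc b * Suc b' + coord_den t j * coord_den t' j * Suc b'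
     \<le> coord_num t' j * coord_den t j * Suc b * Suc b' + coord_den t j * coord_den t' j * Suc b \<longleftrightarrow>
   coord t j + 1 / real (Suc b) \<le> coord t' j + 1 / real (Suc b')" (is "?l \<le> ?r \<longleftrightarrow> _")
proof -
  have "?l \<le> ?r \<longleftrightarrow> real ?l \<le> real ?r" by (simp only: of_nat_le_iff)
  also have "\<dots> \<longleftrightarrow> coord t j + 1 / real (Suc b) \<le> coord t' j + 1 / real (Suc b')"
    unfolding coord_eq of_nat_add of_nat_mult
    by (rule fraction_le_iff) (simp_all only: of_nat_0_less_iff coord_den_pos zero_less_Suc)
  finally show ?thesis .
qed

text \<open>With \<open>a = 0\<close> the radius of the ball is \<open>1 / Suc b\<close>; the last
  condition then forces its cube part into the box about \<open>t'\<close>.\<close>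

lemma accepts_iff:
  "accepts k (prod_encode (prod_encode (s, t), prod_encode (a, b))) n (prod_encode (l, prod_encode (t', b'))) \<longleftrightarrow>
     a = 0 \<and> bit s (box_code k l (take_bit l s) t' b' n) \<and>
     2 ^ box_code k l (take_bit l s) t' b' n \<le> Suc b \<and>
     (\<forall>j<k. \<bar>coord t j - coord t' j\<bar> + 1 / real (Suc b) \<le> 1 / real (Suc b'))"
proof -
  have "coord_num t j * coord_den t' j * Suc b * Suc b' + coord_den t j * coord_den t' j * Suc b'
            \<le> coord_num t' j * coord_den t j * Suc b * Suc b' + coord_den t j * coord_den t' j * Suc b \<and>
          coord_num t' j * coord_den t j * Suc b * Suc b' + coord_den t j * coord_den t' j * Suc b'
            \<le> coord_num t j * coord_den t' j * Suc b * Suc b' + coord_den t j * coord_den t' j * Suc b \<longleftrightarrow>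
        \<bar>coord t j - coord t' j\<bar> + 1 / real (Suc b) \<le> 1 / real (Suc b')" for j
    using coord_le_iff[of t j t' b b'] coord_le_iff[of t' j t b b']
    by (simp only: mult.commute[of "coord_den t' j" "coord_den t j"]) argo
  then show ?thesis
    unfolding accepts_def Let_def prod_encode_inverse fst_conv snd_conv by (simp only:)
qed

lemma computable_coord_num [computable_intros]:
  "computable f \<Longrightarrow> computable g \<Longrightarrow> computable (\<lambda>x. coord_num (f x) (g x))"
  unfolding coord_num_def by (intro computable_intros)

lemma computable_coord_den [computable_intros]:
  "computable f \<Longrightarrow> computable g \<Longrightarrow> computable (\<lambda>x. coord_den (f x) (g x))"
  unfolding coord_den_def by (intro computable_intros)

lemma decidable_accepts:
  "decidable (\<lambda>x. accepts (pfst (pfst x)) (pfst (psnd (pfst x))) (psnd (psnd (pfst x))) (psnd x))"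
  unfolding accepts_def Let_def box_code_def by (intro computable_intros)

text \<open>The index is independent of the closed set, which enters only through the
  oracle.\<close>

definition selector_index :: "nat \<Rightarrow> bool" where
  "selector_index e \<longleftrightarrow> (\<forall>k. W_set e k = {(i, rat_of_code n) | i n. \<exists>w. accepts k i n w})"

lemma prog_of_goedel_number: "prog_of (goedel_number p) = p"
  unfolding prog_of_def using bij_goedel_number by (simp add: bij_is_inj)

lemma exists_selector_index: "\<exists>e. selector_index e"
proof -
  have "\<exists>p. \<forall>x. (\<exists>y. computes p x y) \<longleftrightarrow> (\<exists>w. accepts (pfst x) (pfst (psnd x)) (psnd (psnd x)) w)"
    using decidable_search[OF decidable_accepts] by (simp only: prod_encode_inverse fst_conv snd_conv)
  then obtain p where p: "\<And>x. (\<exists>y. computes p x y) \<longleftrightarrow> (\<exists>w. accepts (pfst x) (pfst (psnd x)) (psnd (psnd x)) w)"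
    by blast
  have "selector_index (goedel_number p)"
    unfolding selector_index_def W_set_def prog_of_goedel_number p by simp
  then show ?thesis ..
qed

section \<open>Bounds for the operators and density of rational centres\<close>

lemma J_op_range: "0 \<le> J_op k W z \<and> J_op k W z \<le> 1"
proof -
  let ?S = "insert 0 {min \<bar>real_of_rat q\<bar> 1 | i q. (i, q) \<in> W \<and> z \<in> rational_ball k i}"
  have bdd: "bdd_above ?S" by (rule bdd_aboveI[of _ 1]) auto
  have "0 \<le> Sup ?S" by (rule cSup_upper[OF _ bdd]) simp
  moreover have "Sup ?S \<le> 1" by (rule cSup_least) auto
  ultimately show ?thesis by (simp only: J_op_def)
qed

lemma J_omega_range: "J_omega e x k \<in> {0..1}"
  using J_op_range by (subst J_omega.simps) simp

lemma J_op_upper: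
  assumes "(i, q) \<in> W" "z \<in> rational_ball k i"
  shows "min \<bar>real_of_rat q\<bar> 1 \<le> J_op k W z"
  unfolding J_op_def using assms by (intro cSup_upper bdd_aboveI[of _ 1]) auto

lemma J_op_least:
  assumes "0 \<le> u" "\<And>i q. (i, q) \<in> W \<Longrightarrow> z \<in> rational_ball k i \<Longrightarrow> min \<bar>real_of_rat q\<bar> 1 \<le> u"
  shows "J_op k W z \<le> u"
  unfolding J_op_def using assms by (intro cSup_least) auto

text \<open>The distance is the power given by the first disagreement. The inequality being strict,
  the agreement includes position \<open>m\<close> itself.\<close>

lemma cantor_dist_less_iff: "cantor_dist x y < (1/2) ^ m \<longleftrightarrow> (\<forall>j\<le>m. x j = y j)"
proof (cases "x = y")
  case False
  define n where "n = (LEAST n. x n \<noteq> y n)"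
  from False have "\<exists>n. x n \<noteq> y n" by blast
  then have n: "x n \<noteq> y n" unfolding n_def by (rule LeastI_ex)
  have less: "x j = y j" if "j < n" for j
    using not_less_Least[OF that[unfolded n_def]] by simp
  have "cantor_dist x y = (1/2) ^ n"
    using False by (simp only: cantor_dist_def n_def if_False)
  then have "cantor_dist x y < (1/2) ^ m \<longleftrightarrow> m < n"
    by (simp add: power_strict_decreasing_iff)
  also have "\<dots> \<longleftrightarrow> (\<forall>j\<le>m. x j = y j)"
    using n less by (meson leI le_less_trans)
  finally show ?thesis .
qed (simp add: cantor_dist_def)

lemma rational_ball_iff:
  assumes "length r = k" "set r \<subseteq> {0..1}"
  shows "(x, r) \<in> rational_ball k (prod_encode (prod_encode (s, t), prod_encode (a, b))) \<longleftrightarrow>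
    cantor_dist (bit s) x < real (Suc a) / real (Suc b) \<and>
    (\<forall>j<k. \<bar>coord t j - r ! j\<bar> < real (Suc a) / real (Suc b))"
  using assms
  by (auto simp: rational_ball_def open_ball_def cube_def coord_def length_tuple_decode nth_tuple_decode)

lemma unit_rat_dense:
  assumes "0 \<le> y" "y \<le> 1"
  obtains u where "\<bar>unit_rat_of_code u - y\<bar> < 1 / real (Suc N)"
proof -
  \<comment> \<open>Rounding down with denominator \<open>N + 2\<close> leaves an error of at most
    \<open>1 / (N + 2)\<close>, which is strictly below \<open>1 / (N + 1)\<close>.\<close>
  define p where "p = nat \<lfloor>y * real (Suc (Suc N))\<rfloor>"
  have p1: "real p \<le> y * real (Suc (Suc N))" "y * real (Suc (Suc N)) < real p + 1"
    using assms(1) unfolding p_def by (simp_all del: of_nat_Suc)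
  have "y * real (Suc (Suc N)) \<le> real (Suc (Suc N))"
    using assms by (simp add: mult_left_le_one_le del: of_nat_Suc)
  with p1(1) have "p \<le> Suc (Suc N)" by linarith
  then have "unit_rat_of_code (prod_encode (p, Suc N)) = real p / real (Suc (Suc N))"
    by (simp add: unit_rat_of_code_def)
  moreover have "\<bar>real p / real (Suc (Suc N)) - y\<bar> \<le> 1 / real (Suc (Suc N))"
  proof -
    have "real p / real (Suc (Suc N)) - y = (real p - y * real (Suc (Suc N))) / real (Suc (Suc N))"
      by (simp add: diff_divide_distrib)
    moreover have "\<bar>real p - y * real (Suc (Suc N))\<bar> \<le> 1" using p1 by linarith
    ultimately show ?thesis by (simp add: divide_right_mono del: of_nat_Suc)
  qed
  moreover have "1 / real (Suc (Suc N)) < 1 / real (Suc N)"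
    by (simp add: field_simps)
  ultimately show thesis by (intro that[of "prod_encode (p, Suc N)"]) linarith
qed

lemma tuple_code_exists: "\<exists>t. \<forall>j<k. pfst ((psnd ^^ j) t) = f j"
proof (induction k arbitrary: f)
  case (Suc k)
  obtain t where t: "\<And>j. j < k \<Longrightarrow> pfst ((psnd ^^ j) t) = f (Suc j)" using Suc[of "\<lambda>j. f (Suc j)"] by blast
  have "pfst ((psnd ^^ j) (prod_encode (f 0, t))) = f j" if "j < Suc k" for j
    using t that by (cases j) (simp_all add: funpow_Suc_right del: funpow.simps(2))
  then show ?case by blast
qed simp

lemma coord_dense:
  assumes "\<And>j. j < k \<Longrightarrow> y j \<in> {0..1}"
  obtains t where "\<And>j. j < k \<Longrightarrow> \<bar>coord t j - y j\<bar> < 1 / real (Suc N)"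
proof -
  have "\<exists>u. j < k \<longrightarrow> \<bar>unit_rat_of_code u - y j\<bar> < 1 / real (Suc N)" for j
    using assms[of j] unit_rat_dense[of "y j" N] by (metis atLeastAtMost_iff)
  then obtain f where f: "\<And>j. j < k \<Longrightarrow> \<bar>unit_rat_of_code (f j) - y j\<bar> < 1 / real (Suc N)" by metis
  obtain t where "\<forall>j<k. pfst ((psnd ^^ j) t) = f j" using tuple_code_exists by blast
  with f show thesis by (intro that[of t]) (simp add: coord_def)
qed

text \<open>The number whose binary digits are the first \<open>l\<close> bits of \<open>x\<close>,
  the form in which ball centres are given; higher bits are \<open>False\<close>.\<close>

definition prefix_code :: "(nat \<Rightarrow> bool) \<Rightarrow> nat \<Rightarrow> nat" where
  "prefix_code x l = horner_sum of_bool 2 (map x [0..<l])"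

lemma bit_prefix_code: "bit (prefix_code x l) j \<longleftrightarrow> j < l \<and> x j"
  by (auto simp: prefix_code_def bit_horner_sum_bit_iff)

lemma take_bit_prefix_code: "l \<le> K \<Longrightarrow> take_bit l (prefix_code x K) = prefix_code x l"
  by (rule bit_eqI) (auto simp: bit_take_bit_iff bit_prefix_code)

text \<open>A lower bound for coordinate \<open>k\<close> on the part of \<open>M\<close> in a
  cylinder and a box, vacuously true if that part is empty. The cap at 1 is that of
  \<open>J_op\<close>.\<close>

definition excluded :: "((nat \<Rightarrow> bool) \<times> (nat \<Rightarrow> real)) set \<Rightarrow> nat \<Rightarrow> nat \<Rightarrow> nat \<Rightarrow> nat \<Rightarrow> nat \<Rightarrow> nat \<Rightarrow> bool" where
  "excluded M k l \<sigma> t b n \<longleftrightarrow>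
     (\<forall>x r. (x, r) \<in> M \<and> (\<forall>j<l. x j \<longleftrightarrow> bit \<sigma> j) \<and> (\<forall>j<k. \<bar>coord t j - r j\<bar> < 1 / real (Suc b)) \<longrightarrow>
        min \<bar>real_of_rat (rat_of_code n)\<bar> 1 \<le> r k)"

text \<open>
  Asking about cylinders \<open>\<sigma>\<close> instead of the section of \<open>M\<close> at the oracle itself is what lets the
  oracle code \<open>M\<close> without circularity.
\<close>

definition closed_set_code :: "((nat \<Rightarrow> bool) \<times> (nat \<Rightarrow> real)) set \<Rightarrow> nat \<Rightarrow> bool" where
  "closed_set_code M m \<longleftrightarrow> excluded M (pfst m) (pfst (psnd m)) (pfst (psnd (psnd m)))
     (pfst (psnd (psnd (psnd m)))) (pfst (psnd (psnd (psnd (psnd m))))) (psnd (psnd (psnd (psnd (psnd m)))))"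

lemma closed_set_code_box_code: "closed_set_code M (box_code k l \<sigma> t b n) \<longleftrightarrow> excluded M k l \<sigma> t b n"
  by (simp add: closed_set_code_def box_code_def)

text \<open>Agreement up to the position of a question thus includes the cylinder the question is
  about.\<close>

lemma le_box_code: "l \<le> box_code k l \<sigma> t b n"
  unfolding box_code_def by (meson le_prod_encode_1 le_prod_encode_2 le_trans)

lemma rat_of_code_surj: "\<exists>n. rat_of_code n = q"
proof -
  obtain a b where q: "q = Fract a b" "b > 0" by (cases q) auto
  have "rat_of_code (prod_encode (int_encode a, nat b - 1)) = q"
    using q by (simp add: rat_of_code_def)
  then show ?thesis ..
qed

text \<open>An accepted ball around the current point reports a true lower bound, so the supremum is
  at most \<open>r k\<close>. Conversely, compactness makes every rational below \<open>r k\<close>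
  a lower bound on some cylinder and box, and a small ball inside them reports it.\<close>

lemma J_op_eq_min:
  fixes J :: "nat \<Rightarrow> real"
  assumes e: "selector_index e" and M: "closed M" "M \<subseteq> UNIV \<times> unit_cube"
    and c: "c = closed_set_code M"
    and J: "\<And>j. J j \<in> {0..1}"
    and r: "(c, r) \<in> M" "\<And>j. j < k \<Longrightarrow> r j = J j"
    and min: "\<And>r'. (c, r') \<in> M \<Longrightarrow> (\<And>j. j < k \<Longrightarrow> r' j = J j) \<Longrightarrow> r k \<le> r' k"
  shows "J_op k (W_set e k) (c, map J [0..<k]) = r k"
proof -
  have r_cube: "r \<in> unit_cube" using r(1) M(2) by blast
  then have r01: "0 \<le> r k" "r k \<le> 1" by (auto simp: unit_cube_def)
  have len: "length (map J [0..<k]) = k" "set (map J [0..<k]) \<subseteq> {0..1}" using J by auto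
  have W: "(i, q) \<in> W_set e k \<longleftrightarrow> (\<exists>n w. q = rat_of_code n \<and> accepts k i n w)" for i q
    using e unfolding selector_index_def by auto
  show ?thesis
  proof (rule antisym)
    show "J_op k (W_set e k) (c, map J [0..<k]) \<le> r k"
    proof (rule J_op_least[OF r01(1)])
      fix i q assume "(i, q) \<in> W_set e k" and ball: "(c, map J [0..<k]) \<in> rational_ball k i"
      then obtain n w where q: "q = rat_of_code n" and acc: "accepts k i n w" using W by blast
      obtain s t a b where i: "i = prod_encode (prod_encode (s, t), prod_encode (a, b))"
        by (metis prod.collapse prod_decode_inverse)
      obtain l t' b' where w: "w = prod_encode (l, prod_encode (t', b'))"
        by (metis prod.collapse prod_decode_inverse)
      define m where "m = box_code k l (take_bit l s) t' b' n"
      have a: "a = 0" and bit: "bit s m" and pow: "2 ^ m \<le> Suc b"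
        and box: "\<And>j. j < k \<Longrightarrow> \<bar>coord t j - coord t' j\<bar> + 1 / real (Suc b) \<le> 1 / real (Suc b')"
        using acc unfolding i w accepts_iff m_def by blast+
      have dist: "cantor_dist (bit s) c < 1 / real (Suc b)"
        and near: "\<And>j. j < k \<Longrightarrow> \<bar>coord t j - J j\<bar> < 1 / real (Suc b)"
        using ball unfolding i rational_ball_iff[OF len] a by simp_all
      have "real (2 ^ m) \<le> real (Suc b)" using pow by (simp only: of_nat_le_iff)
      then have "1 / real (Suc b) \<le> (1/2) ^ m" by (simp add: field_simps power_one_over)
      \<comment> \<open>The bound on the radius makes \<open>c\<close> agree with the centre up to
        and including position \<open>m\<close>, so the bit read there is a genuine answer of the
        oracle.\<close>
      with dist have agree: "\<And>j. j \<le> m \<Longrightarrow> bit s j = c j"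
        using cantor_dist_less_iff[of "bit s" c m] by simp
      have "c m" using bit agree[of m] by simp
      then have "excluded M k l (take_bit l s) t' b' n"
        unfolding c m_def closed_set_code_box_code .
      moreover have "\<forall>j<l. c j \<longleftrightarrow> bit (take_bit l s) j"
        using agree le_box_code[of l k "take_bit l s" t' b' n] by (auto simp: bit_take_bit_iff m_def)
      moreover have "\<forall>j<k. \<bar>coord t' j - r j\<bar> < 1 / real (Suc b')"
      proof (intro allI impI)
        fix j assume j: "j < k"
        show "\<bar>coord t' j - r j\<bar> < 1 / real (Suc b')"
          using box[OF j] near[OF j] r(2)[OF j] by argo
      qed
      ultimately show "min \<bar>real_of_rat q\<bar> 1 \<le> r k"
        using r(1) unfolding excluded_def q by blast
    qed
    show "r k \<le> J_op k (W_set e k) (c, map J [0..<k])"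
    proof (rule ccontr)
      assume "\<not> ?thesis"
      then obtain q where q: "J_op k (W_set e k) (c, map J [0..<k]) < real_of_rat q" "real_of_rat q < r k"
        using of_rat_dense by (meson not_le)
      then have q01: "0 < real_of_rat q" "real_of_rat q < 1"
        using J_op_range[of k "W_set e k" "(c, map J [0..<k])"] r01 by linarith+
      obtain n where n: "rat_of_code n = q" using rat_of_code_surj by blast
      have "\<exists>l t' b'. (\<forall>j<k. \<bar>coord t' j - J j\<bar> < 1 / real (Suc b')) \<and> excluded M k l (prefix_code c l) t' b' n"
      proof (rule ccontr)
        assume not_ex: "\<not> ?thesis"
        \<comment> \<open>Otherwise shrinking cylinders and boxes contain points of \<open>M\<close>
          with coordinate \<open>k\<close> below \<open>q\<close>. A limit of them lies over
          \<open>c\<close>, agrees with \<open>J\<close> below \<open>k\<close> and beats the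
          minimum.\<close>
        have "\<exists>x r'. (x, r') \<in> M \<and> (\<forall>j<l. x j \<longleftrightarrow> c j) \<and> (\<forall>j<k. \<bar>r' j - J j\<bar> < 2 / real (Suc l)) \<and>
            r' k < real_of_rat q" for l
        proof -
          obtain t' where t': "\<And>j. j < k \<Longrightarrow> \<bar>coord t' j - J j\<bar> < 1 / real (Suc l)"
            using coord_dense J by metis
          with not_ex have "\<not> excluded M k l (prefix_code c l) t' l n" by blast
          then obtain x r' where "(x, r') \<in> M" "\<forall>j<l. x j \<longleftrightarrow> bit (prefix_code c l) j"
            "\<forall>j<k. \<bar>coord t' j - r' j\<bar> < 1 / real (Suc l)" "\<not> min \<bar>real_of_rat (rat_of_code n)\<bar> 1 \<le> r' k"
            unfolding excluded_def by blast
          moreover have "\<bar>r' j - J j\<bar> < 2 / real (Suc l)" if "j < k" for j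
            using t'[OF that] calculation(3)[rule_format, OF that] by argo
          ultimately show ?thesis
            using q01 n by (intro exI[of _ x] exI[of _ r']) (auto simp: bit_prefix_code)
        qed
        then obtain x r' where xr: "\<And>l. (x l, r' l) \<in> M" "\<And>l j. j < l \<Longrightarrow> x l j \<longleftrightarrow> c j"
          "\<And>l j. j < k \<Longrightarrow> \<bar>r' l j - J j\<bar> < 2 / real (Suc l)" "\<And>l. r' l k < real_of_rat q"
          by metis
        have "r' l \<in> unit_cube" for l using xr(1) M(2) by blast
        then obtain z \<phi> where z: "strict_mono \<phi>" "(\<lambda>l. r' (\<phi> l)) \<longlonglongrightarrow> z"
          by (rule unit_cube_convergent_subsequence)
        have zj: "(\<lambda>l. r' (\<phi> l) j) \<longlonglongrightarrow> z j" for j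
          using z(2) unfolding tendsto_fun_iff[of "\<lambda>l. r' (\<phi> l)"] by blast
        have "(\<lambda>l. x (\<phi> l)) \<longlonglongrightarrow> c"
          unfolding tendsto_fun_iff
        proof
          fix j
          have "eventually (\<lambda>l. \<phi> l > j) sequentially"
            using eventually_compose_filterlim[OF eventually_gt_at_top filterlim_subseq[OF z(1)]] .
          then have "eventually (\<lambda>l. x (\<phi> l) j = c j) sequentially"
            by eventually_elim (use xr(2) in blast)
          then show "(\<lambda>l. x (\<phi> l) j) \<longlonglongrightarrow> c j" by (rule tendsto_eventually)
        qed
        then have "(\<lambda>l. (x (\<phi> l), r' (\<phi> l))) \<longlonglongrightarrow> (c, z)"
          using z(2) by (rule tendsto_Pair)
        then have cz: "(c, z) \<in> M"
          by (rule Lim_in_closed_set[OF M(1), rotated 2]) (use xr(1) in auto)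
        have "z j = J j" if "j < k" for j
        proof (rule LIMSEQ_unique[OF zj])
          have "(\<lambda>l. 2 * inverse (real (Suc (\<phi> l)))) \<longlonglongrightarrow> 2 * 0"
            using LIMSEQ_subseq_LIMSEQ[OF LIMSEQ_inverse_real_of_nat z(1)]
            by (intro tendsto_mult tendsto_const) (simp add: o_def)
          then have "(\<lambda>l. 2 / real (Suc (\<phi> l))) \<longlonglongrightarrow> 0" by (simp add: divide_inverse)
          then have "(\<lambda>l. r' (\<phi> l) j - J j) \<longlonglongrightarrow> 0"
            by (rule Lim_null_comparison[rotated]) (use xr(3)[OF that] in \<open>auto intro!: always_eventually less_imp_le simp del: of_nat_Suc\<close>)
          then show "(\<lambda>l. r' (\<phi> l) j) \<longlonglongrightarrow> J j" by (simp add: LIM_zero_iff)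
        qed
        then have "r k \<le> z k" by (rule min[OF cz])
        moreover have "z k \<le> real_of_rat q"
          by (rule LIMSEQ_le_const2[OF zj]) (use xr(4) in \<open>auto intro: less_imp_le\<close>)
        ultimately show False using q(2) by linarith
      qed
      then obtain l t' b' where t': "\<And>j. j < k \<Longrightarrow> \<bar>coord t' j - J j\<bar> < 1 / real (Suc b')"
        and ex: "excluded M k l (prefix_code c l) t' b' n" by blast
      define m where "m = box_code k l (prefix_code c l) t' b' n"
      have cm: "c m" using ex unfolding m_def c closed_set_code_box_code .
      \<comment> \<open>The box is open, which leaves room for the error of a rational centre and
        the radius of the ball about it, each at most \<open>1 / Suc b\<close>.\<close>
      have "\<exists>N. \<forall>b\<ge>N. \<forall>j<k. \<bar>coord t' j - J j\<bar> + 2 / real (Suc b) \<le> 1 / real (Suc b')"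
      proof -
        have "eventually (\<lambda>b. \<bar>coord t' j - J j\<bar> + 2 / real (Suc b) \<le> 1 / real (Suc b')) sequentially"
          if "j < k" for j
        proof -
          have "(\<lambda>b. \<bar>coord t' j - J j\<bar> + 2 * inverse (real (Suc b))) \<longlonglongrightarrow> \<bar>coord t' j - J j\<bar> + 2 * 0"
            by (intro tendsto_intros LIMSEQ_inverse_real_of_nat)
          then have "eventually (\<lambda>b. \<bar>coord t' j - J j\<bar> + 2 * inverse (real (Suc b)) < 1 / real (Suc b')) sequentially"
            using t'[OF that] by (intro order_tendstoD(2)) auto
          then show ?thesis by eventually_elim (simp add: divide_inverse)
        qed
        then have "eventually (\<lambda>b. \<forall>j\<in>{..<k}. \<bar>coord t' j - J j\<bar> + 2 / real (Suc b) \<le> 1 / real (Suc b')) sequentially"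
          by (intro eventually_ball_finite) auto
        then show ?thesis by (auto simp: eventually_sequentially)
      qed
      then obtain N where N: "\<And>b j. b \<ge> N \<Longrightarrow> j < k \<Longrightarrow> \<bar>coord t' j - J j\<bar> + 2 / real (Suc b) \<le> 1 / real (Suc b')"
        by blast
      \<comment> \<open>The term \<open>2 ^ m\<close> enforces the radius condition of
        \<open>accepts\<close>.\<close>
      define b where "b = max N (2 ^ m)"
      obtain t where t: "\<And>j. j < k \<Longrightarrow> \<bar>coord t j - J j\<bar> < 1 / real (Suc b)"
        using coord_dense J by metis
      \<comment> \<open>\<open>K\<close> exceeds \<open>m\<close>, so that \<open>s\<close> keeps
        bit \<open>m\<close> and the first \<open>l\<close> bits, and exceeds \<open>b\<close>, so
        that the Cantor distance falls below the radius.\<close>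
      define K where "K = max (Suc m) (Suc b)"
      define s where "s = prefix_code c (Suc K)"
      have lK: "l \<le> Suc K" using le_box_code[of l k "prefix_code c l" t' b' n] unfolding m_def[symmetric] K_def by simp
      have ts: "take_bit l s = prefix_code c l"
        unfolding s_def by (rule take_bit_prefix_code[OF lK])
      define i where "i = prod_encode (prod_encode (s, t), prod_encode (0, b))"
      have "accepts k i n (prod_encode (l, prod_encode (t', b')))"
        unfolding i_def accepts_iff ts m_def[symmetric]
      proof (intro conjI allI impI)
        show "bit s m" using cm by (simp add: s_def bit_prefix_code K_def)
        show "2 ^ m \<le> Suc b" by (simp add: b_def)
        show "\<bar>coord t j - coord t' j\<bar> + 1 / real (Suc b) \<le> 1 / real (Suc b')" if "j < k" for j
        proof -
          have "2 / real (Suc b) = 1 / real (Suc b) + 1 / real (Suc b)" by simp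
          moreover have "b \<ge> N" by (simp add: b_def)
          ultimately show ?thesis using N[OF _ that, of b] t[OF that] by argo
        qed
      qed simp
      then have "(i, q) \<in> W_set e k" unfolding W using n by blast
      moreover have "(c, map J [0..<k]) \<in> rational_ball k i"
        unfolding i_def rational_ball_iff[OF len]
      proof (intro conjI allI impI)
        have "cantor_dist (bit s) c < (1/2) ^ K"
          unfolding cantor_dist_less_iff by (simp add: s_def bit_prefix_code)
        also have "(1/2) ^ K \<le> 1 / real (Suc b)"
        proof -
          have "Suc b \<le> K" by (simp add: K_def)
          also have "K < 2 ^ K" by (rule less_exp)
          finally have "real (Suc b) \<le> real (2 ^ K)" by (simp only: of_nat_le_iff less_imp_le)
          then show ?thesis by (simp add: field_simps power_one_over)
        qed
        finally show "cantor_dist (bit s) c < real (Suc 0) / real (Suc b)" by simp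
        show "\<bar>coord t j - map J [0..<k] ! j\<bar> < real (Suc 0) / real (Suc b)" if "j < k" for j
          using t[OF that] that by simp
      qed
      ultimately have "min \<bar>real_of_rat q\<bar> 1 \<le> J_op k (W_set e k) (c, map J [0..<k])"
        by (rule J_op_upper)
      then show False using q(1) q01 by simp
    qed
  qed
qed

text \<open>The oracle is the code of \<open>M\<close> itself. By induction the section over it has
  points agreeing with \<open>J\<close> below any \<open>k\<close>, and closedness puts their limit
  \<open>J\<close> into the section.\<close>

lemma selector_index_selects:
  assumes e: "selector_index e" and M: "closed M" "M \<subseteq> UNIV \<times> unit_cube" and ne: "\<And>x. \<exists>r. (x, r) \<in> M"
  shows "\<exists>c. (c, J_omega e c) \<in> M"
proof -
  define c where "c = closed_set_code M"
  define J where "J = J_omega e c"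
  define S where "S k = {r. (c, r) \<in> M \<and> (\<forall>j<k. r j = J j)}" for k
  have J_range: "J j \<in> {0..1}" for j unfolding J_def by (rule J_omega_range)
  have S_compact: "compact (S k)" for k
  proof -
    have "closed ((\<lambda>r. (c, r)) -` M)"
      by (rule closed_vimage[OF M(1)]) (intro continuous_intros)
    moreover have "closed {r::nat \<Rightarrow> real. \<forall>j<k. r j = J j}"
      by (intro closed_Collect_all closed_Collect_imp open_Collect_const closed_Collect_eq
        continuous_on_product_coordinates continuous_on_const)
    ultimately have "closed ((\<lambda>r. (c, r)) -` M \<inter> {r. \<forall>j<k. r j = J j})" by (rule closed_Int)
    moreover have "S k = unit_cube \<inter> ((\<lambda>r. (c, r)) -` M \<inter> {r. \<forall>j<k. r j = J j})"
      using M(2) unfolding S_def by blast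
    ultimately show ?thesis using compact_Int_closed[OF compact_unit_cube] by simp
  qed
  have S_ne: "S k \<noteq> {}" for k
  proof (induction k)
    case 0
    show ?case using ne[of c] by (simp add: S_def)
  next
    case (Suc k)
    \<comment> \<open>Coordinate \<open>k\<close> is minimized on the compact set
      \<open>S k\<close>; by \<open>J_op_eq_min\<close> the minimum is \<open>J k\<close>, so
      \<open>r\<close> lies in \<open>S (Suc k)\<close>.\<close>
    obtain r where r: "r \<in> S k" "\<And>r'. r' \<in> S k \<Longrightarrow> r k \<le> r' k"
      using continuous_attains_inf[OF S_compact Suc, of "\<lambda>r. r k"]
        continuous_on_product_coordinates[of k] continuous_on_subset by (metis subset_UNIV)
    have "J k = J_op k (W_set e k) (c, map J [0..<k])"
      unfolding J_def by (subst J_omega.simps) simp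
    also have "\<dots> = r k"
      using r by (intro J_op_eq_min[OF e M c_def J_range]) (auto simp: S_def)
    finally have "r \<in> S (Suc k)" using r(1) by (auto simp: S_def less_Suc_eq)
    then show ?case by blast
  qed
  then have "\<forall>k. \<exists>r. r \<in> S k" by auto
  then obtain r where r: "\<And>k. r k \<in> S k" unfolding choice_iff by blast
  have "(\<lambda>k. r k) \<longlonglongrightarrow> J"
    unfolding tendsto_fun_iff
  proof
    fix j
    have "eventually (\<lambda>k. r k j = J j) sequentially"
      using eventually_gt_at_top[of j] by eventually_elim (use r in \<open>auto simp: S_def\<close>)
    then show "(\<lambda>k. r k j) \<longlonglongrightarrow> J j" by (rule tendsto_eventually)
  qed
  then have "(\<lambda>k. (c, r k)) \<longlonglongrightarrow> (c, J)" by (intro tendsto_Pair tendsto_const)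
  then have "(c, J) \<in> M"
    by (rule Lim_in_closed_set[OF M(1), rotated 2]) (use r in \<open>auto simp: S_def\<close>)
  then show ?thesis unfolding J_def by blast
qed


section \<open>Zero-dimensional sets\<close>

lemma open_cylinder: "open {y :: nat \<Rightarrow> bool. \<forall>i<b. y i = x i}"
proof -
  have "open ((\<lambda>y :: nat \<Rightarrow> bool. y i) -` {x i})" for i
    by (rule open_vimage[OF open_discrete continuous_on_product_coordinates])
  then have "open (\<Inter>i<b. (\<lambda>y :: nat \<Rightarrow> bool. y i) -` {x i})"
    by (intro open_INT) auto
  moreover have "(\<Inter>i<b. (\<lambda>y :: nat \<Rightarrow> bool. y i) -` {x i}) = {y. \<forall>i<b. y i = x i}"
    by auto
  ultimately show ?thesis by simp
qed

lemma open_contains_cylinder: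
  fixes U :: "(nat \<Rightarrow> bool) set"
  assumes "open U" "x \<in> U"
  obtains b where "{y. \<forall>i<b. y i = x i} \<subseteq> U"
proof (rule ccontr)
  assume "\<not> thesis"
  with that have "\<forall>b. \<exists>y. (\<forall>i<b. y i = x i) \<and> y \<notin> U" by blast
  then obtain y where y: "\<And>b i. i < b \<Longrightarrow> y b i = x i" "\<And>b. y b \<notin> U" by metis
  have "y \<longlonglongrightarrow> x"
    unfolding tendsto_fun_iff
  proof
    fix i
    have "eventually (\<lambda>b. y b i = x i) sequentially"
      using eventually_gt_at_top[of i] by eventually_elim (use y in blast)
    then show "(\<lambda>b. y b i) \<longlonglongrightarrow> x i" by (rule tendsto_eventually)
  qed
  then have "eventually (\<lambda>b. y b \<in> U) sequentially"
    using assms by (rule topological_tendstoD)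
  then show False using y(2) by simp
qed

text \<open>By \<open>base\<close> the \<open>h\<close>-cylinders form a neighbourhood base in
  \<open>Z\<close>. The shortest cylinders lying in \<open>low\<close> or \<open>high\<close>
  partition \<open>Z\<close> into clopen pieces, so \<open>Z\<close> splits into two parts that
  remain separated after the two closed sets are added.\<close>

lemma zero_dimensional_separation:
  fixes h :: "'a::topological_space \<Rightarrow> nat \<Rightarrow> bool" and p :: "'a \<Rightarrow> real"
  assumes metr: "metrizable_space (euclidean :: 'a topology)"
    and p: "continuous_on UNIV p"
    and h: "continuous_on Z h"
    and base: "\<And>z W. z \<in> Z \<Longrightarrow> open W \<Longrightarrow> z \<in> W \<Longrightarrow> \<exists>b. \<forall>z'\<in>Z. (\<forall>i<b. h z' i = h z i) \<longrightarrow> z' \<in> W"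
  obtains U V where "open U" "open V" "U \<inter> V = {}" "{z. p z \<le> 0} \<subseteq> U" "{z. p z \<ge> 1} \<subseteq> V" "Z \<subseteq> U \<union> V"
proof -
  have op: "open {z. p z < a}" "open {z. p z > a}" for a
    using p by (auto intro!: open_Collect_less continuous_intros)
  define cyl where "cyl b z = {z' \<in> Z. \<forall>i<b. h z' i = h z i}" for b z
  \<comment> \<open>These sets cover the space, so some cylinder about each point of
    \<open>Z\<close> lies in one of them, and each leaves a gap to the opposite closed set.\<close>
  define low high where "low = {z. p z < 2/3}" and "high = {z. p z > 1/3}"
  define dec where "dec b z \<longleftrightarrow> cyl b z \<subseteq> low \<or> cyl b z \<subseteq> high" for b z
  define b where "b z = (LEAST b. dec b z)" for z
  have dec: "dec (b z) z" if "z \<in> Z" for z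
  proof -
    have "\<exists>c. dec c z"
    proof (cases "p z < 1/2")
      case True
      then have "z \<in> low" by (simp add: low_def)
      then show ?thesis
        using base[OF that op(1)[of "2/3"]] unfolding dec_def cyl_def low_def by blast
    next
      case False
      then have "z \<in> high" by (simp add: high_def)
      then show ?thesis
        using base[OF that op(2)[of "1/3"]] unfolding dec_def cyl_def high_def by blast
    qed
    then show ?thesis unfolding b_def by (rule LeastI_ex)
  qed
  have cyl_cong: "cyl c z' = cyl c z" if "z' \<in> cyl d z" "c \<le> d" for c d z z'
    using that unfolding cyl_def by auto
  \<comment> \<open>For \<open>c < b z\<close> the cylinders of length \<open>c\<close> about
    \<open>z\<close> and \<open>z'\<close> coincide, so neither point is decided before the
    other.\<close>
  have b_cong: "b z' = b z" if "z \<in> Z" "z' \<in> cyl (b z) z" for z z'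
    unfolding b_def[of z']
  proof (rule Least_equality)
    show "dec (b z) z'" using dec[OF that(1)] cyl_cong[OF that(2) order_refl] by (simp add: dec_def)
    fix c assume c: "dec c z'"
    show "b z \<le> c"
    proof (rule ccontr)
      assume "\<not> b z \<le> c"
      then have "c < b z" by simp
      then have "dec c z" using c cyl_cong[OF that(2), of c] by (simp add: dec_def)
      then show False using not_less_Least[of c "\<lambda>b. dec b z"] \<open>c < b z\<close> by (simp add: b_def)
    qed
  qed
  define E1 E2 where "E1 = {z \<in> Z. cyl (b z) z \<subseteq> low}" and "E2 = {z \<in> Z. \<not> cyl (b z) z \<subseteq> low}"
  have self: "z \<in> cyl c z" if "z \<in> Z" for z c using that by (simp add: cyl_def)
  have E1_low: "E1 \<subseteq> low"
  proof
    fix z assume "z \<in> E1"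
    then show "z \<in> low" using self[of z "b z"] by (auto simp: E1_def)
  qed
  have E2_high: "E2 \<subseteq> high"
  proof
    fix z assume "z \<in> E2"
    then show "z \<in> high" using self[of z "b z"] dec[of z] by (auto simp: E2_def dec_def)
  qed
  have cyl_open: "\<exists>W. open W \<and> W \<inter> Z = cyl c z" for c z
  proof -
    obtain W where "open W" "W \<inter> Z = h -` {y. \<forall>i<c. y i = h z i} \<inter> Z"
      using continuous_on_open_invariant[THEN iffD1, OF h, THEN spec, THEN mp, OF open_cylinder[of c "h z"]]
      by (elim exE conjE)
    moreover have "h -` {y. \<forall>i<c. y i = h z i} \<inter> Z = cyl c z" by (auto simp: cyl_def)
    ultimately show ?thesis by (intro exI[of _ W]) simp
  qed
  have nbhd: "\<exists>W. open W \<and> z \<in> W \<and> W \<inter> Z \<subseteq> cyl (b z) z" if "z \<in> Z" for z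
  proof -
    obtain W where "open W" "W \<inter> Z = cyl (b z) z" using cyl_open[of "b z" z] by (elim exE conjE)
    then show ?thesis using self[OF that, of "b z"] by (intro exI[of _ W]) auto
  qed
  have same: "z' \<in> E1 \<longleftrightarrow> z \<in> E1" if "z \<in> Z" "z' \<in> cyl (b z) z" for z z'
  proof -
    have "cyl (b z') z' = cyl (b z) z"
      using b_cong[OF that] cyl_cong[OF that(2) order_refl] by simp
    moreover have "z' \<in> Z" using that(2) by (simp add: cyl_def)
    ultimately show ?thesis using that(1) by (simp add: E1_def)
  qed
  have E1_cyl: "cyl (b z) z \<inter> E2 = {}" if "z \<in> E1" for z
  proof -
    have "z \<in> Z" using that by (simp add: E1_def)
    then have "z' \<in> E1" if "z' \<in> cyl (b z) z" for z' using same that \<open>z \<in> E1\<close> by simp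
    then show ?thesis by (auto simp: E1_def E2_def)
  qed
  have E2_cyl: "cyl (b z) z \<inter> E1 = {}" if "z \<in> E2" for z
  proof -
    have "z \<in> Z" "z \<notin> E1" using that by (auto simp: E1_def E2_def)
    then have "z' \<notin> E1" if "z' \<in> cyl (b z) z" for z' using same that by simp
    then show ?thesis by auto
  qed
  let ?S = "{z. p z \<le> 0} \<union> E1" and ?T = "{z. p z \<ge> 1} \<union> E2"
  have Z: "E1 \<subseteq> Z" "E2 \<subseteq> Z" "Z = E1 \<union> E2" unfolding E1_def E2_def by auto
  have S_nbhd: "\<exists>W. open W \<and> z \<in> W \<and> W \<inter> ?T = {}" if "z \<in> ?S" for z
    using that
  proof
    assume "z \<in> {z. p z \<le> 0}"
    then show ?thesis
      using op(1)[of "1/3"] E2_high by (intro exI[of _ "{z. p z < 1/3}"]) (auto simp: high_def)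
  next
    assume z: "z \<in> E1"
    then obtain W where W: "open W" "z \<in> W" "W \<inter> Z \<subseteq> cyl (b z) z" using nbhd Z(1) by blast
    have "W \<inter> low \<inter> ?T = {}" using W(3) E1_cyl[OF z] Z(2) by (fastforce simp: low_def)
    then show ?thesis
      using W op(1)[of "2/3"] z E1_low by (intro exI[of _ "W \<inter> low"]) (auto simp: low_def)
  qed
  have T_nbhd: "\<exists>W. open W \<and> z \<in> W \<and> W \<inter> ?S = {}" if "z \<in> ?T" for z
    using that
  proof
    assume "z \<in> {z. p z \<ge> 1}"
    then show ?thesis
      using op(2)[of "2/3"] E1_low by (intro exI[of _ "{z. p z > 2/3}"]) (auto simp: low_def)
  next
    assume z: "z \<in> E2"
    then obtain W where W: "open W" "z \<in> W" "W \<inter> Z \<subseteq> cyl (b z) z" using nbhd Z(2) by blast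
    have "W \<inter> high \<inter> ?S = {}" using W(3) E2_cyl[OF z] Z(1) by (fastforce simp: high_def)
    then show ?thesis
      using W op(2)[of "1/3"] z E2_high by (intro exI[of _ "W \<inter> high"]) (auto simp: high_def)
  qed
  have closure_disjoint: "S \<inter> closure T = {}"
    if "\<And>z. z \<in> S \<Longrightarrow> \<exists>W. open W \<and> z \<in> W \<and> W \<inter> T = {}" for S T :: "'a set"
    using that open_Int_closure_eq_empty by blast
  have "separatedin euclidean ?S ?T"
    unfolding separatedin_def
    using closure_disjoint[of ?S ?T, OF S_nbhd] closure_disjoint[of ?T ?S, OF T_nbhd]
    by (simp only: euclidean_closure_of topspace_euclidean subset_UNIV simp_thms)
  then obtain U V where "open U" "open V" "?S \<subseteq> U" "?T \<subseteq> V" "disjnt U V"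
    using metrizable_space_separation[OF metr] by (metis open_openin)
  then show thesis using Z(3) by (intro that[of U V]) (auto simp: disjnt_def)
qed

lemma metrizable_cantor_times_reals:
  "metrizable_space (euclidean :: ((nat \<Rightarrow> bool) \<times> (nat \<Rightarrow> real)) topology)"
proof -
  have "(euclidean :: bool topology) = discrete_topology UNIV"
    by (simp add: topology_eq open_openin[symmetric] open_discrete)
  then have "metrizable_space (euclidean :: bool topology)" by simp
  then have "metrizable_space (product_topology (\<lambda>_::nat. euclidean :: bool topology) UNIV)"
    by (subst metrizable_space_product_topology) simp
  then have "metrizable_space (euclidean :: (nat \<Rightarrow> bool) topology)"
    by (simp only: euclidean_product_topology)
  then have "metrizable_space (prod_topology (euclidean :: (nat \<Rightarrow> bool) topology) (euclidean :: (nat \<Rightarrow> real) topology))"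
    by (subst metrizable_space_prod_topology) (simp add: metrizable_space_euclidean)
  then show ?thesis by (simp only: prod_topology_euclidean)
qed

text \<open>A partition of the product restricts to a partition of the cube over every
  \<open>x\<close>.\<close>

lemma sections_separate:
  assumes "open U" "open V" "U \<inter> V = {}" "{z. snd z i \<le> 0} \<subseteq> U" "{z. snd z i \<ge> 1} \<subseteq> V"
  shows "separates i {r. (x, r) \<in> U} {r. (x, r) \<in> V}"
proof -
  have "open ((\<lambda>r. (x, r)) -` U)" "open ((\<lambda>r. (x, r)) -` V)"
    using assms(1,2) by (auto intro!: open_vimage continuous_intros)
  then have "open {r. (x, r) \<in> U}" "open {r. (x, r) \<in> V}" by (simp_all add: vimage_def)
  then show ?thesis using assms(3-5) unfolding separates_def by fastforce
qed

text \<open>Partition \<open>i\<close> is chosen to miss \<open>Z i\<close>. The cube is essential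
  in all directions at once, so the intersection \<open>M\<close> of the partitions has nonempty
  sections, and the graph point selected from \<open>M\<close> lies in no
  \<open>Z n\<close>.\<close>

lemma selector_graph_not_zero_dimensional_Union:
  fixes h :: "nat \<Rightarrow> (nat \<Rightarrow> bool) \<times> (nat \<Rightarrow> real) \<Rightarrow> nat \<Rightarrow> bool"
  assumes e: "selector_index e"
    and h: "\<And>n. continuous_on (Z n) (h n)"
    and base: "\<And>n z W. z \<in> Z n \<Longrightarrow> open W \<Longrightarrow> z \<in> W \<Longrightarrow>
      \<exists>b. \<forall>z'\<in>Z n. (\<forall>i<b. h n z' i = h n z i) \<longrightarrow> z' \<in> W"
  shows "\<exists>c. \<forall>n. (c, J_omega e c) \<notin> Z n"
proof -
  have "\<exists>p. open (fst p) \<and> open (snd p) \<and> fst p \<inter> snd p = {} \<and> {z. snd z i \<le> 0} \<subseteq> fst p \<and>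
      {z. snd z i \<ge> 1} \<subseteq> snd p \<and> Z i \<subseteq> fst p \<union> snd p" for i
  proof -
    have "continuous_on UNIV (\<lambda>z :: (nat \<Rightarrow> bool) \<times> (nat \<Rightarrow> real). snd z i)"
      by (rule continuous_on_product_then_coordinatewise) (intro continuous_intros)
    then obtain U V where "open U" "open V" "U \<inter> V = {}" "{z. snd z i \<le> 0} \<subseteq> U" "{z. snd z i \<ge> 1} \<subseteq> V"
      "Z i \<subseteq> U \<union> V"
      by (rule zero_dimensional_separation[OF metrizable_cantor_times_reals _ h base])
    then show ?thesis by (intro exI[of _ "(U, V)"]) simp
  qed
  then obtain p where p: "\<And>i. open (fst (p i)) \<and> open (snd (p i)) \<and> fst (p i) \<inter> snd (p i) = {} \<and>
      {z. snd z i \<le> 0} \<subseteq> fst (p i) \<and> {z. snd z i \<ge> 1} \<subseteq> snd (p i) \<and> Z i \<subseteq> fst (p i) \<union> snd (p i)"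
    by metis
  define M where "M = UNIV \<times> unit_cube - (\<Union>i. fst (p i) \<union> snd (p i))"
  have "closed (UNIV \<times> unit_cube)"
    using compact_unit_cube by (intro closed_Times compact_imp_closed) auto
  moreover have "open (\<Union>i. fst (p i) \<union> snd (p i))"
    using p by (intro open_UN ballI open_Un) auto
  ultimately have "closed M" unfolding M_def by (rule closed_Diff)
  moreover have "\<exists>r. (x, r) \<in> M" for x
  proof -
    have "separates i {r. (x, r) \<in> fst (p i)} {r. (x, r) \<in> snd (p i)}" for i
      using p[of i] by (intro sections_separate) auto
    then have "\<exists>r\<in>unit_cube. \<forall>i\<in>UNIV. r \<notin> {r. (x, r) \<in> fst (p i)} \<union> {r. (x, r) \<in> snd (p i)}"
      by (intro essentialD[OF essential_unit_cube])
    then show ?thesis unfolding M_def by auto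
  qed
  moreover have "M \<subseteq> UNIV \<times> unit_cube" unfolding M_def by blast
  ultimately obtain c where "(c, J_omega e c) \<in> M"
    using selector_index_selects[OF e] by metis
  then have "(c, J_omega e c) \<notin> Z n" for n
    using p[of n] unfolding M_def by blast
  then show ?thesis by blast
qed


section \<open>The intermediate type\<close>

definition CEA_graph :: "(nat \<times> (nat \<Rightarrow> bool) \<times> (nat \<Rightarrow> real)) set" where
  "CEA_graph = {(e, x, r). r = J_omega e x}"

lemma omega_CEA_eq: "omega_CEA = top_of_set CEA_graph"
proof -
  have "{(e, x, r). (\<forall>k. r k \<in> {0..1}) \<and> r = J_omega e x} = CEA_graph"
    using J_omega_range unfolding CEA_graph_def by auto
  then show ?thesis unfolding omega_CEA_def by simp
qed

lemma hilbert_cube_eq: "hilbert_cube = top_of_set unit_cube"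
  by (simp add: hilbert_cube_def unit_cube_def)

text \<open>For maps that are continuous outright; only the inverse is cut into pieces, the images
  of the \<open>C n\<close>.\<close>

lemma sigma_embedsI:
  assumes cont: "continuous_map X Y f" and inj: "inj_on f (topspace X)"
    and C: "topspace X = (\<Union>n::nat. C n)"
    and g: "\<And>n. continuous_map (subtopology Y (f ` C n)) X (g n)" "\<And>n x. x \<in> C n \<Longrightarrow> g n (f x) = x"
  shows "X \<le>\<^sub>\<sigma> Y"
proof -
  define S where "S = f ` topspace X"
  have S: "S \<subseteq> topspace Y"
    unfolding S_def using cont by (rule continuous_map_image_subset_topspace)
  then have top: "topspace (subtopology Y S) = S" by auto
  have "sigma_homeomorphic_map X (subtopology Y S) f"
    unfolding sigma_homeomorphic_map_def
  proof (intro conjI)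
    show "bij_betw f (topspace X) (topspace (subtopology Y S))"
      unfolding top using inj by (simp add: bij_betw_def S_def)
    have "continuous_map X (subtopology Y S) f"
      using cont by (simp add: continuous_map_in_subtopology S_def)
    then show "sigma_continuous_map X (subtopology Y S) f"
      unfolding sigma_continuous_map_def by (intro exI[of _ "\<lambda>_. topspace X"]) simp
    have "continuous_map (subtopology (subtopology Y S) (f ` C n)) X (inv_into (topspace X) f)" for n
    proof (rule continuous_map_eq)
      have sub: "f ` C n \<subseteq> S" unfolding S_def C by blast
      then have eq: "subtopology (subtopology Y S) (f ` C n) = subtopology Y (f ` C n)"
        by (simp add: subtopology_subtopology inf_absorb2)
      show "continuous_map (subtopology (subtopology Y S) (f ` C n)) X (g n)"
        unfolding eq by (rule g(1))
      fix y assume "y \<in> topspace (subtopology (subtopology Y S) (f ` C n))"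
      then obtain x where x: "x \<in> C n" "y = f x" by auto
      then have "x \<in> topspace X" using C by blast
      then have "inv_into (topspace X) f y = x"
        using inj x(2) by (simp add: inv_into_f_f)
      then show "g n y = inv_into (topspace X) f y" using g(2) x by simp
    qed
    moreover have "topspace (subtopology Y S) = (\<Union>n. f ` C n)"
      unfolding top by (simp only: S_def C image_UN)
    ultimately show "sigma_continuous_map (subtopology Y S) X (inv_into (topspace X) f)"
      unfolding sigma_continuous_map_def by (intro exI[of _ "\<lambda>n. f ` C n"] conjI allI)
  qed
  then show ?thesis
    using S unfolding sigma_embeds_def sigma_homeomorphic_space_def by blast
qed

text \<open>A search for a witness of falsity never halts, so all sets \<open>W_set e k\<close> are
  empty and each supremum is the default 0.\<close>

lemma exists_zero_index: "\<exists>e. \<forall>x. J_omega e x = (\<lambda>_. 0)"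
proof -
  have "decidable (\<lambda>_. False)" unfolding decidable_def by (rule computable_const)
  then obtain p where "\<And>x y. \<not> computes p x y" using decidable_search by blast
  then have W: "W_set (goedel_number p) k = {}" for k
    by (simp add: W_set_def prog_of_goedel_number)
  have "J_omega (goedel_number p) x k = 0" for x k
    by (subst J_omega.simps) (simp add: W J_op_def del: J_omega.simps)
  then show ?thesis by blast
qed

lemma cantor_space_embeds_omega_CEA: "cantor_space \<le>\<^sub>\<sigma> omega_CEA"
proof -
  obtain e where e: "\<And>x. J_omega e x = (\<lambda>_. 0)" using exists_zero_index by blast
  define f :: "(nat \<Rightarrow> bool) \<Rightarrow> nat \<times> (nat \<Rightarrow> bool) \<times> (nat \<Rightarrow> real)" where "f x = (e, x, \<lambda>_. 0)" for x
  show ?thesis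
  proof (rule sigma_embedsI[of _ _ f "\<lambda>_. UNIV" "\<lambda>_ z. fst (snd z)"])
    have "continuous_on UNIV f" unfolding f_def by (intro continuous_intros)
    moreover have "range f \<subseteq> CEA_graph" using e by (auto simp: f_def CEA_graph_def)
    ultimately show "continuous_map cantor_space omega_CEA f"
      by (simp add: cantor_space_def omega_CEA_eq continuous_map_in_subtopology image_subset_iff_funcset)
    show "inj_on f (topspace cantor_space)" by (auto simp: inj_on_def f_def)
    show "continuous_map (subtopology omega_CEA (f ` UNIV)) cantor_space (\<lambda>z. fst (snd z))"
      unfolding cantor_space_def omega_CEA_eq subtopology_subtopology continuous_map_iff_continuous
      by (intro continuous_intros)
  qed (auto simp: cantor_space_def f_def)
qed

lemma omega_CEA_embeds_hilbert_cube: "omega_CEA \<le>\<^sub>\<sigma> hilbert_cube"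
proof -
  \<comment> \<open>Coordinate 0 carries the index \<open>e\<close> as \<open>1 / (e + 1)\<close>,
    odd coordinates carry the bits of \<open>x\<close>, and the remaining even ones carry
    \<open>r\<close>.\<close>
  define f :: "nat \<times> (nat \<Rightarrow> bool) \<times> (nat \<Rightarrow> real) \<Rightarrow> nat \<Rightarrow> real" where
    "f z n = (if n = 0 then 1 / real (Suc (fst z))
      else if odd n then of_bool (fst (snd z) (n div 2)) else snd (snd z) (n div 2 - 1))" for z n
  \<comment> \<open>The decoder on a single section, where \<open>e\<close> is a known
    constant.\<close>
  define g :: "nat \<Rightarrow> (nat \<Rightarrow> real) \<Rightarrow> nat \<times> (nat \<Rightarrow> bool) \<times> (nat \<Rightarrow> real)" where
    "g e y = (e, \<lambda>j. y (2 * j + 1) > 1/2, \<lambda>j. y (2 * j + 2))" for e y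
  define C where "C e = {z \<in> CEA_graph. fst z = e}" for e
  have gf: "g (fst z) (f z) = z" for z
    by (simp add: f_def g_def prod_eq_iff)
  have f0: "f z 0 = 1 / real (Suc (fst z))" for z by (simp add: f_def)
  show ?thesis
  proof (rule sigma_embedsI[of _ _ f C g])
    have "continuous_on UNIV (\<lambda>z. f z n)" for n
    proof -
      have fst_snd: "continuous_on UNIV (\<lambda>z :: nat \<times> (nat \<Rightarrow> bool) \<times> (nat \<Rightarrow> real). fst (snd z) j)" for j
        by (rule continuous_on_product_then_coordinatewise) (intro continuous_intros)
      have snd_snd: "continuous_on UNIV (\<lambda>z :: nat \<times> (nat \<Rightarrow> bool) \<times> (nat \<Rightarrow> real). snd (snd z) j)" for j
        by (rule continuous_on_product_then_coordinatewise) (intro continuous_intros)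
      have discr: "continuous_on UNIV (\<lambda>z. h (k z))"
        if "continuous_on UNIV k" for h :: "'b::discrete_topology \<Rightarrow> real"
          and k :: "nat \<times> (nat \<Rightarrow> bool) \<times> (nat \<Rightarrow> real) \<Rightarrow> 'b"
        by (rule continuous_on_compose2[OF _ that, of UNIV]) auto
      consider "n = 0" | "n \<noteq> 0" "odd n" | "n \<noteq> 0" "even n" by blast
      then show ?thesis
      proof cases
        case 1
        then show ?thesis
          using discr[of fst "\<lambda>e. 1 / real (Suc e)"] unfolding f_def by (simp add: continuous_on_fst)
      next
        case 2
        then show ?thesis using discr[OF fst_snd, of of_bool] unfolding f_def by simp
      next
        case 3
        then show ?thesis using snd_snd unfolding f_def by simp
      qed
    qed
    then have "continuous_on UNIV f" by (rule continuous_on_coordinatewise_then_product)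
    then have "continuous_on CEA_graph f" by (rule continuous_on_subset) simp
    moreover have "f ` CEA_graph \<subseteq> unit_cube"
      using J_omega_range by (auto simp: f_def unit_cube_def CEA_graph_def simp del: J_omega.simps)
    ultimately show "continuous_map omega_CEA hilbert_cube f"
      by (simp add: hilbert_cube_eq omega_CEA_eq continuous_map_in_subtopology image_subset_iff_funcset)
    show "inj_on f (topspace omega_CEA)"
    proof (rule inj_onI)
      fix z z' assume eq: "f z = f z'"
      then have "1 / real (Suc (fst z)) = 1 / real (Suc (fst z'))" using f0 by metis
      then have "fst z = fst z'" by (simp add: field_simps)
      then show "z = z'" using eq gf by metis
    qed
    show "topspace omega_CEA = (\<Union>n. C n)" by (auto simp: omega_CEA_eq C_def)
    show "g e (f z) = z" if "z \<in> C e" for e z using gf[of z] that by (simp add: C_def)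
    show "continuous_map (subtopology hilbert_cube (f ` C e)) omega_CEA (g e)" for e
    proof -
      \<comment> \<open>On the image the odd coordinates are 0 or 1, which makes the threshold test
        at \<open>1/2\<close> continuous.\<close>
      have bits: "y (2 * j + 1) \<in> {0, 1}" if "y \<in> f ` C e" for y j
        using that by (auto simp: f_def)
      have "continuous_on (f ` C e) (\<lambda>y. y (2 * j + 1) > 1/2)" for j
      proof (rule continuous_on_compose2[of "{0, 1}" "\<lambda>t::real. t > 1/2"])
        show "continuous_on {0, 1} (\<lambda>t::real. t > 1/2)" by (rule continuous_on_finite) simp
        show "continuous_on (f ` C e) (\<lambda>y. y (2 * j + 1))"
          by (rule continuous_on_subset[OF continuous_on_product_coordinates]) simp
        show "(\<lambda>y. y (2 * j + 1)) ` f ` C e \<subseteq> {0, 1}" using bits by blast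
      qed
      then have "continuous_on (f ` C e) (\<lambda>y j. y (2 * j + 1) > 1/2)"
        by (rule continuous_on_coordinatewise_then_product)
      moreover have "continuous_on (f ` C e) (\<lambda>y j. y (2 * j + 2))"
        by (intro continuous_on_coordinatewise_then_product continuous_on_subset[OF continuous_on_product_coordinates]) simp
      ultimately have "continuous_on (f ` C e) (g e)"
        unfolding g_def by (intro continuous_on_Pair continuous_on_const)
      moreover have "g e ` f ` C e \<subseteq> CEA_graph"
        using gf by (auto simp: C_def)
      moreover have "unit_cube \<inter> f ` C e \<subseteq> f ` C e" by blast
      ultimately show ?thesis
        unfolding hilbert_cube_eq omega_CEA_eq subtopology_subtopology
        by (auto simp: continuous_map_in_subtopology intro: continuous_on_subset)
    qed
  qed
qed

text \<open>The section at a selector index would be a countable union of pieces homeomorphic to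
  subsets of Cantor space, hence of zero-dimensional sets.\<close>

lemma cantor_space_not_sigma_homeomorphic_omega_CEA: "\<not> sigma_homeomorphic_space cantor_space omega_CEA"
proof
  assume "sigma_homeomorphic_space cantor_space omega_CEA"
  then obtain f where f: "sigma_homeomorphic_map cantor_space omega_CEA f"
    unfolding sigma_homeomorphic_space_def by blast
  define g where "g = inv_into (topspace cantor_space) f"
  have bij: "bij_betw f UNIV CEA_graph"
    using f unfolding sigma_homeomorphic_map_def by (simp add: cantor_space_def omega_CEA_eq)
  have fg: "f (g y) = y" if "y \<in> CEA_graph" for y
    unfolding g_def using bij that by (simp add: cantor_space_def bij_betw_def f_inv_into_f)
  obtain A where A: "UNIV = (\<Union>n::nat. A n)" "\<And>n. continuous_on (A n) f"
  proof -
    obtain A where "topspace cantor_space = (\<Union>n::nat. A n)"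
      "\<forall>n. continuous_map (subtopology cantor_space (A n)) omega_CEA f"
      using f unfolding sigma_homeomorphic_map_def sigma_continuous_map_def by blast
    then show thesis
      by (intro that[of A]) (simp_all add: cantor_space_def omega_CEA_eq continuous_map_in_subtopology)
  qed
  obtain B where B: "CEA_graph = (\<Union>n::nat. B n)" "\<And>n. continuous_on (CEA_graph \<inter> B n) g"
  proof -
    obtain B where "topspace omega_CEA = (\<Union>n::nat. B n)"
      "\<forall>n. continuous_map (subtopology omega_CEA (B n)) cantor_space g"
      using f unfolding sigma_homeomorphic_map_def sigma_continuous_map_def g_def by blast
    then show thesis
      by (intro that[of B]) (simp_all add: cantor_space_def omega_CEA_eq subtopology_subtopology)
  qed
  obtain e where e: "selector_index e" using exists_selector_index by blast
  \<comment> \<open>The index \<open>i\<close> codes a piece \<open>B\<close> on which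
    \<open>g\<close> is continuous and a piece \<open>A\<close> on which \<open>f\<close>
    is.\<close>
  define Z where "Z i = {z. (e, z) \<in> CEA_graph \<inter> B (pfst i) \<and> g (e, z) \<in> A (psnd i)}" for i
  have "\<exists>c. \<forall>n. (c, J_omega e c) \<notin> Z n"
  proof (rule selector_graph_not_zero_dimensional_Union[OF e])
    show "continuous_on (Z i) (\<lambda>z. g (e, z))" for i
      by (rule continuous_on_compose2[OF B(2)[of "pfst i"]]) (auto simp: Z_def intro!: continuous_intros)
    fix i z W assume z: "z \<in> Z i" "open W" "z \<in> W"
    have "open (UNIV \<times> W :: (nat \<times> (nat \<Rightarrow> bool) \<times> (nat \<Rightarrow> real)) set)" using z(2) by (intro open_Times) auto
    \<comment> \<open>Continuity of \<open>f\<close> on its piece pulls \<open>W\<close> back to an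
      open set, in which a cylinder about \<open>g (e, z)\<close> is then found.\<close>
    from continuous_on_open_invariant[THEN iffD1, OF A(2), THEN spec, THEN mp, OF this, of "psnd i"]
    obtain G where G: "open G" "G \<inter> A (psnd i) = f -` (UNIV \<times> W) \<inter> A (psnd i)" by (elim exE conjE)
    have "g (e, z) \<in> f -` (UNIV \<times> W) \<inter> A (psnd i)" using z fg by (simp add: Z_def)
    with G(2) have "g (e, z) \<in> G" by blast
    then obtain b where b: "{y. \<forall>i<b. y i = g (e, z) i} \<subseteq> G" by (rule open_contains_cylinder[OF G(1)])
    have "z' \<in> W" if "z' \<in> Z i" "\<forall>i<b. g (e, z') i = g (e, z) i" for z'
    proof -
      have "g (e, z') \<in> G \<inter> A (psnd i)" using that b by (auto simp: Z_def)
      then have "f (g (e, z')) \<in> UNIV \<times> W" using G(2) by blast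
      then show ?thesis using that(1) fg by (simp add: Z_def)
    qed
    then show "\<exists>b. \<forall>z'\<in>Z i. (\<forall>i<b. g (e, z') i = g (e, z) i) \<longrightarrow> z' \<in> W" by blast
  qed
  then obtain c where c: "\<And>i. (c, J_omega e c) \<notin> Z i" by blast
  have y: "(e, c, J_omega e c) \<in> CEA_graph" by (simp add: CEA_graph_def)
  then obtain n where n: "(e, c, J_omega e c) \<in> B n" using B(1) by blast
  obtain m where m: "g (e, c, J_omega e c) \<in> A m" using A(1) by blast
  have "(c, J_omega e c) \<in> Z (prod_encode (n, m))" using y n m by (simp add: Z_def del: J_omega.simps)
  then show False using c by blast
qed

text \<open>Inside one section a graph point is determined by its Cantor coordinate, so the inverse
  bijection yields continuous injections into Cantor space on countably many pieces of the
  cube.\<close>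

lemma omega_CEA_not_sigma_homeomorphic_hilbert_cube: "\<not> sigma_homeomorphic_space omega_CEA hilbert_cube"
proof
  assume "sigma_homeomorphic_space omega_CEA hilbert_cube"
  then obtain f where f: "sigma_homeomorphic_map omega_CEA hilbert_cube f"
    unfolding sigma_homeomorphic_space_def by blast
  define g where "g = inv_into (topspace omega_CEA) f"
  have bij: "bij_betw g unit_cube CEA_graph"
    using f bij_betw_inv_into unfolding g_def sigma_homeomorphic_map_def
    by (fastforce simp: hilbert_cube_eq omega_CEA_eq)
  obtain A where A: "unit_cube = (\<Union>n::nat. A n)" "\<And>n. continuous_on (unit_cube \<inter> A n) g"
  proof -
    obtain A where "topspace hilbert_cube = (\<Union>n::nat. A n)"
      "\<forall>n. continuous_map (subtopology hilbert_cube (A n)) omega_CEA g"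
      using f unfolding sigma_homeomorphic_map_def sigma_continuous_map_def g_def by blast
    then show thesis
      by (intro that[of A]) (simp_all add: hilbert_cube_eq omega_CEA_eq subtopology_subtopology continuous_map_in_subtopology)
  qed
  \<comment> \<open>The index codes a piece of continuity together with the section that
    \<open>g\<close> maps into.\<close>
  define X where "X i = {z \<in> unit_cube \<inter> A (pfst i). fst (g z) = psnd i}" for i
  have "\<not> unit_cube \<subseteq> (\<Union>i. X i)"
  proof (rule unit_cube_not_Union_injective)
    show "continuous_on (X i) (\<lambda>z. fst (snd (g z)))" for i
      by (intro continuous_on_fst continuous_on_snd continuous_on_subset[OF A(2)[of "pfst i"]]) (auto simp: X_def)
    show "inj_on (\<lambda>z. fst (snd (g z))) (X i)" for i
    proof (rule inj_onI)
      fix z z' assume z: "z \<in> X i" "z' \<in> X i" "fst (snd (g z)) = fst (snd (g z'))"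
      then have "z \<in> unit_cube" "z' \<in> unit_cube" "fst (g z) = fst (g z')" by (simp_all add: X_def)
      moreover have "g z \<in> CEA_graph" "g z' \<in> CEA_graph"
        using bij \<open>z \<in> unit_cube\<close> \<open>z' \<in> unit_cube\<close> by (auto simp: bij_betw_def)
      then have "snd (snd (g z)) = J_omega (fst (g z)) (fst (snd (g z)))"
        "snd (snd (g z')) = J_omega (fst (g z')) (fst (snd (g z')))"
        by (auto simp: CEA_graph_def simp del: J_omega.simps)
      ultimately have "g z = g z'" using z(3) by (simp add: prod_eq_iff del: J_omega.simps)
      then show "z = z'" using bij \<open>z \<in> unit_cube\<close> \<open>z' \<in> unit_cube\<close> by (meson bij_betw_def inj_onD)
    qed
  qed
  moreover have "unit_cube \<subseteq> (\<Union>i. X i)"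
  proof
    fix z assume "z \<in> unit_cube"
    then obtain n where "z \<in> A n" using A(1) by blast
    then have "z \<in> X (prod_encode (n, fst (g z)))" using \<open>z \<in> unit_cube\<close> by (simp add: X_def)
    then show "z \<in> (\<Union>i. X i)" by blast
  qed
  ultimately show False by blast
qed

theorem theorem4p5:
  shows "cantor_space <\<^sub>\<sigma> omega_CEA \<and> omega_CEA <\<^sub>\<sigma> hilbert_cube"
  unfolding sigma_less_def
  using cantor_space_embeds_omega_CEA omega_CEA_embeds_hilbert_cube
    cantor_space_not_sigma_homeomorphic_omega_CEA omega_CEA_not_sigma_homeomorphic_hilbert_cube by blast

end
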